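(* Let $\Omega\subset\mathbb{R}^\nu$, $g$, $f$, $\lambda$, the value function $u$, the family of triangulations and the fully discrete solution $u_k^h$ be as in the context. Let $\gamma=1$ if $L_g<\lambda$, $\gamma=\lambda/L_g$ if $L_g>\lambda$, and let $\gamma$ be any number in $(0,1)$ if $L_g=\lambda$. Let $c_1,c_2>0$ be constants. Then there is a constant $C$, independent of $h$ and $k$, such that whenever the admissible parameters $h,k$ satisfy $c_1k^{2/3}\le h\le c_2k^{2/3}$, one has $$|u(x,a)-u_k^h(x,a)|\le C\,k^{\frac23\gamma}\qquad\text{for all }x\in\Omega_k,\ a\in I_h .$$
   Context: Continuous problem. $\Omega\subset\mathbb{R}^\nu$ is open, $\lambda>0$, $g:\Omega\times[0,1]\to\mathbb{R}^\nu$ and $f:\Omega\times[0,1]\to\mathbb{R}$ satisfy, for positive constants $L_g,M_g,L_f,M_f$ and all $x,\bar x\in\Omega$, $a,\bar a\in[0,1]$: $\|g(x,a)-g(\bar x,\bar a)\|\le L_g(\|x-\bar x\|+|a-\bar a|)$, $\|g(x,a)\|\le M_g$, $|f(x,a)-f(\bar x,\bar a)|\le L_f(\|x-\bar x\|+|a-\bar a|)$, $|f(x,a)|\le M_f$. For $a\in[0,1]$, $\mathcal{A}(a)$ is the set of non-decreasing functions $\alpha:[0,+\infty)\to[0,1]$ with $\alpha(0)\ge a$. For $x\in\Omega$ and $\alpha\in\mathcal{A}(a)$, $y$ solves $\dot y(s)=g(y(s),\alpha(s))$, $s>0$, $y(0)=x$; it is assumed that $y(s)$ stays in $\Omega$ for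 every control. The value function is $u(x,a)=\inf_{\alpha\in\mathcal{A}(a)}\int_0^\infty f(y(s),\alpha(s))e^{-\lambda s}\,ds$. Discretization. $h>0$ with $1/h$ an integer, $I_h=\{ih: i=0,\dots,1/h\}$, $I_h(a)=I_h\cap[a,1]$. For each $k$ one has a triangulation $\{S_j^k\}_j$ by simplices, with $\Omega_k=\bigcup_j S_j^k$ a polyhedron, such that: (T1) $\max_j \operatorname{diam}S_j^k=k$; (T2) there is $h_0>0$ (independent of $k$) such that $x+hg(x,a)\in\Omega_k$ for all $x\in\Omega_k$, $a\in I_h$, $0<h<h_0$; (T3) $\Omega_k\subset\Omega$, and for every compact $K\subset\Omega$ there is $\bar k(K)$ with $K\subset\Omega_k$ for all $k\le\bar k(K)$; (T4) there is $\chi_1>0$ (independent of the discretization) such that each simplex $S_i^k$, of diameter $d_i$, contains in its interior a sphere of radius $r\ge\chi_1 d_i$; (T5) there is $\chi_2$ (independent of the discretization) with $k/d_i\le\chi_2$ for all $i$. $V^k=\{x^i: i=1,\dots,N\}$ is the set of vertices of the simplices. $W_k$ is the set of functions $w:\Omega_k\times I_h\to\mathbb{R}$ such that $w(\cdot,a)$ is continuous on $\Omega_k$ and affine on each simplex; such $w$ is determined by its values $w(x^i,a)$. The operator $A_k^h:W_k\to W_k$ is defined by $$(A_k^hw)(x^i,a)=\min_{b\in I_h(a)}\{(1-\lambda h)\,w(x^i+hg(x^i,a),b)+hf(x^i,a)\},\quad x^i\in V^k,\ a\in I_h .$$ Parameters are admissible when $0<h<\min(h_0,1/\lambda)$ and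 $1/h$ is an integer; then $A_k^h$ is a contraction for the max norm over vertices and $I_h$, and $u_k^h\in W_k$ denotes its unique fixed point. "Independent of $h,k$" means that the constant depends only on the data $\lambda,M_g,M_f,L_g,L_f,\nu$, the constants of (T2), (T4), (T5), the constants $c_1,c_2$ (and on $\gamma$ in the case $L_g=\lambda$). *)

theory Defs
  imports "HOL-Analysis.Analysis"
begin

section \<open>The continuous problem\<close>

definition lipschitz_bounded ::
  "'a::real_normed_vector set \<Rightarrow> real \<Rightarrow> real \<Rightarrow> ('a \<Rightarrow> real \<Rightarrow> 'b::real_normed_vector) \<Rightarrow> bool" where
  "lipschitz_bounded \<Omega> L M \<phi> \<longleftrightarrow>
     (\<forall>x\<in>\<Omega>. \<forall>x'\<in>\<Omega>. \<forall>a\<in>{0..1}. \<forall>a'\<in>{0..1}.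
        norm (\<phi> x a - \<phi> x' a') \<le> L * (norm (x - x') + \<bar>a - a'\<bar>)) \<and>
     (\<forall>x\<in>\<Omega>. \<forall>a\<in>{0..1}. norm (\<phi> x a) \<le> M)"

text \<open>Controls are functions on \<^term>\<open>{0::real..}\<close>; their values at negative times play no role.\<close>

definition controls :: "real \<Rightarrow> (real \<Rightarrow> real) set" where
  "controls a = {\<alpha>. mono_on {0..} \<alpha> \<and> \<alpha> ` {0..} \<subseteq> {0..1} \<and> a \<le> \<alpha> 0}"

text \<open>A monotone control may jump, so the equation \<open>y' = g(y, \<alpha>)\<close>, \<open>y(0) = x\<close> is understood in
  the Caratheodory sense, i.e. in integrated form. As \<open>g\<close> is only given on \<open>\<Omega>\<close>, a solution has
  to take its values there.\<close>

definition trajectory ::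
  "'a::euclidean_space set \<Rightarrow> ('a \<Rightarrow> real \<Rightarrow> 'a) \<Rightarrow> 'a \<Rightarrow> (real \<Rightarrow> real) \<Rightarrow> (real \<Rightarrow> 'a) \<Rightarrow> bool" where
  "trajectory \<Omega> g x \<alpha> y \<longleftrightarrow>
     y 0 = x \<and>
     (\<forall>t\<ge>0. y t \<in> \<Omega> \<and> ((\<lambda>s. g (y s) (\<alpha> s)) has_integral (y t - x)) {0..t})"

definition viable :: "'a::euclidean_space set \<Rightarrow> ('a \<Rightarrow> real \<Rightarrow> 'a) \<Rightarrow> bool" where
  "viable \<Omega> g \<longleftrightarrow>
     (\<forall>x\<in>\<Omega>. \<forall>a\<in>{0..1}. \<forall>\<alpha>\<in>controls a. \<exists>y. trajectory \<Omega> g x \<alpha> y)"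

text \<open>For Lipschitz \<open>g\<close> the trajectory is determined on \<^term>\<open>{0::real..}\<close> by \<open>x\<close> and \<open>\<alpha>\<close>, so
  the infimum over pairs \<open>(\<alpha>, y)\<close> is the infimum over controls.\<close>

definition value_function ::
  "'a::euclidean_space set \<Rightarrow> real \<Rightarrow> ('a \<Rightarrow> real \<Rightarrow> 'a) \<Rightarrow> ('a \<Rightarrow> real \<Rightarrow> real) \<Rightarrow> 'a \<Rightarrow> real \<Rightarrow> real" where
  "value_function \<Omega> lam g f x a =
     Inf {integral {0..} (\<lambda>s. f (y s) (\<alpha> s) * exp (- lam * s)) | \<alpha> y.
            \<alpha> \<in> controls a \<and> trajectory \<Omega> g x \<alpha> y}"


section \<open>The discretization\<close>

definition control_grid :: "real \<Rightarrow> real set" where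
  "control_grid h = {real i * h | i. real i \<le> 1 / h}"

text \<open>\<open>\<K>\<close> is the set of mesh sizes for which a triangulation is given. It is kept
  arbitrary: for bounded \<open>\<Omega>\<close>, the mesh size cannot range over all positive reals. The
  inscribed balls force all simplices to be of full dimension. The domain \<open>\<Omega>\<^sub>k = \<Union>(\<T> k)\<close> need not be
  convex, hence the library's (convex) notion \<^const>\<open>polyhedron\<close> is not used.\<close>

definition triangulation_family ::
  "'a::euclidean_space set \<Rightarrow> ('a \<Rightarrow> real \<Rightarrow> 'a) \<Rightarrow> real \<Rightarrow> real \<Rightarrow> real \<Rightarrow>
   real set \<Rightarrow> (real \<Rightarrow> 'a set set) \<Rightarrow> bool" where
  "triangulation_family \<Omega> g h0 \<chi>1 \<chi>2 \<K> \<T> \<longleftrightarrow>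
     \<K> \<subseteq> {0<..} \<and>
     (\<forall>k\<in>\<K>. triangulation (\<T> k) \<and> \<T> k \<noteq> {}) \<and>
     (\<forall>k\<in>\<K>. Max (diameter ` \<T> k) = k) \<and>
     (\<forall>k\<in>\<K>. \<forall>h. 0 < h \<and> h < h0 \<and> 1 / h \<in> \<nat> \<longrightarrow>
        (\<forall>x\<in>\<Union>(\<T> k). \<forall>a\<in>control_grid h. x + h *\<^sub>R g x a \<in> \<Union>(\<T> k))) \<and>
     (\<forall>k\<in>\<K>. \<Union>(\<T> k) \<subseteq> \<Omega>) \<and>
     (\<forall>K. compact K \<and> K \<subseteq> \<Omega> \<longrightarrow>
        (\<exists>kbar>0. \<forall>k\<in>\<K>. k \<le> kbar \<longrightarrow> K \<subseteq> \<Union>(\<T> k))) \<and>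
     (\<forall>k\<in>\<K>. \<forall>S\<in>\<T> k. \<exists>z r. r \<ge> \<chi>1 * diameter S \<and> cball z r \<subseteq> interior S) \<and>
     (\<forall>k\<in>\<K>. \<forall>S\<in>\<T> k. k / diameter S \<le> \<chi>2)"

definition mesh_vertices :: "'a::euclidean_space set set \<Rightarrow> 'a set" where
  "mesh_vertices \<T> = {v. \<exists>S\<in>\<T>. v extreme_point_of S}"

text \<open>The space \<open>W\<^sub>k\<close>; only the restriction of its elements to \<open>\<Omega>\<^sub>k \<times> I\<^sub>h\<close> is meaningful.\<close>

definition fe_space :: "'a::euclidean_space set set \<Rightarrow> real \<Rightarrow> ('a \<Rightarrow> real \<Rightarrow> real) set" where
  "fe_space \<T> h =
     {w. \<forall>a\<in>control_grid h.
           continuous_on (\<Union>\<T>) (\<lambda>x. w x a) \<and>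
           (\<forall>S\<in>\<T>. \<exists>c d. \<forall>x\<in>S. w x a = c \<bullet> x + d)}"

text \<open>The value \<open>(A w)(x, a)\<close> at a vertex \<open>x\<close> and \<open>a \<in> I\<^sub>h\<close>.\<close>

definition discrete_operator ::
  "real \<Rightarrow> ('a::euclidean_space \<Rightarrow> real \<Rightarrow> 'a) \<Rightarrow> ('a \<Rightarrow> real \<Rightarrow> real) \<Rightarrow> real \<Rightarrow>
   ('a \<Rightarrow> real \<Rightarrow> real) \<Rightarrow> 'a \<Rightarrow> real \<Rightarrow> real" where
  "discrete_operator lam g f h w x a =
     Min {(1 - lam * h) * w (x + h *\<^sub>R g x a) b + h * f x a | b. b \<in> control_grid h \<inter> {a..1}}"

text \<open>An element of \<open>W\<^sub>k\<close> is determined on \<open>\<Omega>\<^sub>k \<times> I\<^sub>h\<close> by its values at the vertices, so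
  \<open>A w = w\<close> amounts to equality there.\<close>

definition discrete_solution ::
  "real \<Rightarrow> ('a::euclidean_space \<Rightarrow> real \<Rightarrow> 'a) \<Rightarrow> ('a \<Rightarrow> real \<Rightarrow> real) \<Rightarrow> 'a set set \<Rightarrow> real \<Rightarrow>
   ('a \<Rightarrow> real \<Rightarrow> real) \<Rightarrow> bool" where
  "discrete_solution lam g f \<T> h w \<longleftrightarrow>
     w \<in> fe_space \<T> h \<and>
     (\<forall>x\<in>mesh_vertices \<T>. \<forall>a\<in>control_grid h. w x a = discrete_operator lam g f h w x a)"

end

(* Interpolating at z replaces z by a random vertex with mean z and distance at most k from z, so u_kh
   is the value of a controlled Markov chain whose steps are Euler steps perturbed by centred
   increments of size k. Against the unperturbed Euler path steered by the same controls these
   increments accumulate in mean square only, to k * sqrt (t / h) rather than k * t / h after time t.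
   A monotone control has total variation at most 1, so piecewise constant grid-valued controls and
   the Euler scheme cost an error of order h, and h is comparable with k / sqrt h when h is
   comparable with k powr (2/3). Errors grow like exp (Lg * t) and are discounted by exp (- lam * t);
   comparing up to a finite horizon and optimizing it yields the exponent gamma. *)
theory Submission
  imports Defs
begin

section \<open>The control grid and the discrete operator\<close>

text \<open>The chain may choose its next control according to the vertex just drawn, whereas an
  Euler path follows one fixed sequence. The comparison is therefore made on the two dynamic
  programming equations, where both sides minimise over the same next control. The price is that the
  error bound must be a function of the current distance \<open>d\<close> that one step reproduces.
  The distance itself is not reproduced: averaging it over the vertices of a cell can add an amount
  of order \<open>k\<close> at each step. Its square only gains \<open>k\<^sup>2\<close>, but grows
  with \<open>\<rho>\<^sup>2\<close> and does not match the Lipschitz bound on \<open>f\<close>. The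
  function \<open>sqrt (d\<^sup>2 + \<eta>)\<close> combines the cancellation of the square with the
  growth rate of the distance.

  The bridge is \<open>horizon_value\<close>, the value of finitely many undisturbed Euler steps. It
  is compared with both solutions from the same starting point, so no modulus of continuity of the
  value function enters. The number of steps stays free until the end, because for
  \<open>Lg > lam\<close> the error accumulated up to the horizon grows with it, while the neglected
  tail decays.\<close>

lemma lipschitz_bounded_mono:
  assumes "lipschitz_bounded \<Omega> L M \<phi>" and "L \<le> L'"
  shows "lipschitz_bounded \<Omega> L' M \<phi>"
proof -
  have "norm (\<phi> x a - \<phi> x' a') \<le> L' * (norm (x - x') + \<bar>a - a'\<bar>)"
    if "x \<in> \<Omega>" "x' \<in> \<Omega>" "a \<in> {0..1}" "a' \<in> {0..1}" for x x' a a'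
  proof -
    have "norm (\<phi> x a - \<phi> x' a') \<le> L * (norm (x - x') + \<bar>a - a'\<bar>)"
      using assms(1) that unfolding lipschitz_bounded_def by blast
    also have "\<dots> \<le> L' * (norm (x - x') + \<bar>a - a'\<bar>)"
      using assms(2) by (intro mult_right_mono) auto
    finally show ?thesis .
  qed
  with assms(1) show ?thesis
    unfolding lipschitz_bounded_def by blast
qed

lemma lipschitz_boundedD:
  assumes "lipschitz_bounded \<Omega> L M \<phi>" "x \<in> \<Omega>" "x' \<in> \<Omega>" "a \<in> {0..1}" "a' \<in> {0..1}"
  shows "norm (\<phi> x a - \<phi> x' a') \<le> L * (norm (x - x') + \<bar>a - a'\<bar>)"
  using assms unfolding lipschitz_bounded_def by blast

lemma lipschitz_bounded_normD:
  assumes "lipschitz_bounded \<Omega> L M \<phi>" "x \<in> \<Omega>" "a \<in> {0..1}"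
  shows "norm (\<phi> x a) \<le> M"
  using assms unfolding lipschitz_bounded_def by blast

lemma control_grid_subset:
  assumes "h > 0"
  shows "control_grid h \<subseteq> {0..1}"
  using assms by (auto simp: control_grid_def field_simps)

lemma finite_control_grid:
  assumes "h > 0"
  shows "finite (control_grid h)"
proof -
  have "control_grid h \<subseteq> (\<lambda>i. real i * h) ` {..nat \<lfloor>1 / h\<rfloor>}"
    by (auto simp: control_grid_def le_nat_floor)
  then show ?thesis
    by (rule finite_subset) simp
qed

lemma discrete_operator_image:
  "discrete_operator lam g f h w x a =
     Min ((\<lambda>b. (1 - lam * h) * w (x + h *\<^sub>R g x a) b + h * f x a) ` (control_grid h \<inter> {a..1}))"
proof -
  have "{(1 - lam * h) * w (x + h *\<^sub>R g x a) b + h * f x a | b. b \<in> control_grid h \<inter> {a..1}} =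
      (\<lambda>b. (1 - lam * h) * w (x + h *\<^sub>R g x a) b + h * f x a) ` (control_grid h \<inter> {a..1})"
    by auto
  then show ?thesis
    by (simp add: discrete_operator_def)
qed

lemma control_grid_Int:
  assumes "h > 0" "a \<in> control_grid h"
  shows "finite (control_grid h \<inter> {a..1})" "a \<in> control_grid h \<inter> {a..1}"
  using assms finite_control_grid[OF assms(1)] control_grid_subset[OF assms(1)] by auto

lemma discrete_operator_le:
  assumes "h > 0" "a \<in> control_grid h" "b \<in> control_grid h" "a \<le> b"
  shows "discrete_operator lam g f h w x a \<le> (1 - lam * h) * w (x + h *\<^sub>R g x a) b + h * f x a"
  unfolding discrete_operator_image
  using assms control_grid_Int(1)[OF assms(1,2)] control_grid_subset[OF assms(1)]
  by (intro Min_le finite_imageI imageI) auto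

lemma discrete_operator_attained:
  assumes "h > 0" "a \<in> control_grid h"
  obtains b where "b \<in> control_grid h" "a \<le> b"
    "discrete_operator lam g f h w x a = (1 - lam * h) * w (x + h *\<^sub>R g x a) b + h * f x a"
proof -
  have "discrete_operator lam g f h w x a \<in>
      (\<lambda>b. (1 - lam * h) * w (x + h *\<^sub>R g x a) b + h * f x a) ` (control_grid h \<inter> {a..1})"
    unfolding discrete_operator_image using control_grid_Int[OF assms] by (intro Min_in) auto
  then show thesis
    using that by auto
qed

text \<open>Each minimiser is a competitor on the other side, so a bound uniform in the common next
  control passes to the minima. Two systems in different states can thus be compared without knowing
  either optimal control.\<close>

lemma discrete_operator_diff_le:
  assumes "h > 0" "a \<in> control_grid h"
    and "\<And>b. b \<in> control_grid h \<Longrightarrow> a \<le> b \<Longrightarrow>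
      \<bar>((1 - lam * h) * w (x + h *\<^sub>R g x a) b + h * f x a) -
       ((1 - lam * h) * v (y + h *\<^sub>R g y a) b + h * f y a)\<bar> \<le> e"
  shows "\<bar>discrete_operator lam g f h w x a - discrete_operator lam g f h v y a\<bar> \<le> e"
proof -
  obtain b where b: "b \<in> control_grid h" "a \<le> b"
    "discrete_operator lam g f h w x a = (1 - lam * h) * w (x + h *\<^sub>R g x a) b + h * f x a"
    using discrete_operator_attained[OF assms(1,2)] .
  obtain c where c: "c \<in> control_grid h" "a \<le> c"
    "discrete_operator lam g f h v y a = (1 - lam * h) * v (y + h *\<^sub>R g y a) c + h * f y a"
    using discrete_operator_attained[OF assms(1,2)] .
  show ?thesis
    using assms(3)[OF b(1,2)] assms(3)[OF c(1,2)] b(3) c(3)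
      discrete_operator_le[OF assms(1,2) b(1,2), of lam g f v y]
      discrete_operator_le[OF assms(1,2) c(1,2), of lam g f w x]
    by linarith
qed

section \<open>Interpolation on a triangulation\<close>

lemma triangulation_cell_hull:
  assumes "triangulation \<T>" "S \<in> \<T>"
  obtains C where "finite C" "S = convex hull C"
proof -
  have "\<exists>n. n simplex S"
    using assms by (simp add: triangulation_def)
  then show thesis
    using that unfolding simplex by blast
qed

lemma finite_mesh_vertices:
  assumes "triangulation \<T>"
  shows "finite (mesh_vertices \<T>)"
proof -
  have "finite {v. v extreme_point_of S}" if "S \<in> \<T>" for S
  proof -
    obtain C where C: "finite C" "S = convex hull C"
      using triangulation_cell_hull[OF assms \<open>S \<in> \<T>\<close>] .
    then have "{v. v extreme_point_of S} \<subseteq> C"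
      using extreme_point_of_convex_hull by blast
    then show ?thesis
      using C(1) finite_subset by blast
  qed
  moreover have "mesh_vertices \<T> = (\<Union>S\<in>\<T>. {v. v extreme_point_of S})"
    by (auto simp: mesh_vertices_def)
  ultimately show ?thesis
    using assms by (simp add: triangulation_def)
qed

lemma mesh_vertices_subset: "mesh_vertices \<T> \<subseteq> \<Union>\<T>"
  by (auto simp: mesh_vertices_def extreme_point_of_def)

text \<open>Affine functions commute with convex combinations: weights that write \<open>z\<close>
  as a mean of the vertices of its cell also write \<open>w z a\<close> as a mean of vertex values.
  They depend on \<open>z\<close> alone and serve all controls at once.\<close>

lemma mesh_interpolation:
  assumes "triangulation \<T>" "Max (diameter ` \<T>) = k" "z \<in> \<Union>\<T>" "w \<in> fe_space \<T> h"
  obtains P \<mu> where "P \<subseteq> mesh_vertices \<T>" "\<forall>p\<in>P. 0 \<le> \<mu> p" "sum \<mu> P = 1"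
    "(\<Sum>p\<in>P. \<mu> p *\<^sub>R p) = z" "\<forall>p\<in>P. norm (p - z) \<le> k"
    "\<forall>a\<in>control_grid h. w z a = (\<Sum>p\<in>P. \<mu> p * w p a)"
proof -
  obtain S where S: "S \<in> \<T>" "z \<in> S"
    using assms(3) by blast
  obtain C where C: "finite C" "S = convex hull C"
    using triangulation_cell_hull[OF assms(1) S(1)] .
  \<comment> \<open>The generators of the cell are exchanged for its extreme points, by which
    \<open>mesh_vertices\<close> is defined.\<close>
  define P where "P = {v. v extreme_point_of S}"
  have "P \<subseteq> C"
    using C(2) extreme_point_of_convex_hull unfolding P_def by blast
  then have finP: "finite P"
    using C(1) finite_subset by blast
  have "S = convex hull P"
    unfolding P_def using C by (intro Krein_Milman_Minkowski) (auto simp: finite_imp_compact_convex_hull)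
  then obtain \<mu> where \<mu>: "\<And>p. p \<in> P \<Longrightarrow> 0 \<le> \<mu> p" "sum \<mu> P = 1" "(\<Sum>p\<in>P. \<mu> p *\<^sub>R p) = z"
    using S(2) convex_hull_finite[OF finP] by auto
  have PS: "P \<subseteq> S"
    by (auto simp: P_def extreme_point_of_def)
  have near: "norm (p - z) \<le> k" if "p \<in> P" for p
  proof -
    have "bounded S"
      using C by (simp add: compact_imp_bounded finite_imp_compact_convex_hull)
    then have "dist p z \<le> diameter S"
      using that PS S(2) by (intro diameter_bounded_bound) auto
    also have "\<dots> \<le> k"
      using assms(1) S(1) unfolding assms(2)[symmetric] by (intro Max_ge) (auto simp: triangulation_def)
    finally show ?thesis
      by (simp add: dist_norm)
  qed
  have interp: "w z a = (\<Sum>p\<in>P. \<mu> p * w p a)" if a: "a \<in> control_grid h" for a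
  proof -
    obtain c d where cd: "\<And>x. x \<in> S \<Longrightarrow> w x a = c \<bullet> x + d"
      using assms(4) a S(1) unfolding fe_space_def by blast
    have "(\<Sum>p\<in>P. \<mu> p * w p a) = (\<Sum>p\<in>P. c \<bullet> (\<mu> p *\<^sub>R p) + \<mu> p * d)"
      using PS cd by (intro sum.cong) (auto simp: algebra_simps)
    also have "\<dots> = c \<bullet> z + d"
      unfolding sum.distrib inner_sum_right[symmetric] sum_distrib_right[symmetric] \<mu>(2,3) by simp
    finally show ?thesis
      using cd S(2) by simp
  qed
  have vert: "P \<subseteq> mesh_vertices \<T>"
    using S(1) by (auto simp: P_def mesh_vertices_def)
  show thesis
    using vert \<mu> near interp by (intro that[of P \<mu>]) auto
qed

lemma convex_combination_diff_le:
  fixes \<mu> F B :: "'a \<Rightarrow> real"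
  assumes "\<And>p. p \<in> P \<Longrightarrow> 0 \<le> \<mu> p" "sum \<mu> P = 1" "\<And>p. p \<in> P \<Longrightarrow> \<bar>F p - v\<bar> \<le> B p"
  shows "\<bar>(\<Sum>p\<in>P. \<mu> p * F p) - v\<bar> \<le> (\<Sum>p\<in>P. \<mu> p * B p)"
proof -
  have "(\<Sum>p\<in>P. \<mu> p * F p) - v = (\<Sum>p\<in>P. \<mu> p * (F p - v))"
    using assms(2) by (simp add: right_diff_distrib sum_subtractf sum_distrib_right[symmetric])
  also have "\<bar>\<dots>\<bar> \<le> (\<Sum>p\<in>P. \<bar>\<mu> p * (F p - v)\<bar>)"
    by simp
  also have "\<dots> \<le> (\<Sum>p\<in>P. \<mu> p * B p)"
    using assms(1,3) by (intro sum_mono) (simp add: abs_mult mult_left_mono)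
  finally show ?thesis .
qed

text \<open>The first-order term cancels because \<open>z\<close> is the barycentre: the interpolation error enters
  quadratically, as a variance, and not linearly in \<open>k\<close>.\<close>

lemma sum_sqrt_barycentre_le:
  fixes z y :: "'a::real_inner"
  assumes "\<And>p. p \<in> P \<Longrightarrow> 0 \<le> \<mu> p" "sum \<mu> P = 1" "(\<Sum>p\<in>P. \<mu> p *\<^sub>R p) = z"
    and "\<And>p. p \<in> P \<Longrightarrow> norm (p - z) \<le> k" and "\<eta> > 0"
  shows "(\<Sum>p\<in>P. \<mu> p * sqrt ((norm (p - y))\<^sup>2 + \<eta>)) \<le> sqrt ((norm (z - y))\<^sup>2 + k\<^sup>2 + \<eta>)"
proof -
  \<comment> \<open>\<open>t\<close> is the square of the claimed bound and dominates the mean of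
    the radicands. Concavity enters through the tangent of the square root at \<open>t\<close>,
    \<open>sqrt s \<le> (s + t) / (2 * sqrt t)\<close>, which is affine in \<open>s\<close> and can
    be averaged exactly; \<open>\<eta> > 0\<close> keeps its slope finite.\<close>
  define t where "t = (norm (z - y))\<^sup>2 + k\<^sup>2 + \<eta>"
  have t: "t > 0"
    unfolding t_def using assms(5) by (intro add_nonneg_pos) auto
  have centred: "(\<Sum>p\<in>P. \<mu> p *\<^sub>R (p - z)) = 0"
    by (simp add: scaleR_diff_right sum_subtractf scaleR_left.sum[symmetric] assms(2,3))
  have expand: "(norm (p - y))\<^sup>2 = (norm (z - y))\<^sup>2 + (norm (p - z))\<^sup>2 + 2 * ((p - z) \<bullet> (z - y))" for p
  proof -
    show ?thesis
      unfolding power2_norm_eq_inner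
      by (simp add: inner_diff_left inner_diff_right inner_commute)
  qed
  have "(\<Sum>p\<in>P. \<mu> p * (norm (p - y))\<^sup>2) =
      (\<Sum>p\<in>P. \<mu> p * (norm (z - y))\<^sup>2 + \<mu> p * (norm (p - z))\<^sup>2 + 2 * ((\<mu> p *\<^sub>R (p - z)) \<bullet> (z - y)))"
    by (intro sum.cong refl, subst expand) (simp add: distrib_left)
  also have "\<dots> = (\<Sum>p\<in>P. \<mu> p * (norm (z - y))\<^sup>2) + (\<Sum>p\<in>P. \<mu> p * (norm (p - z))\<^sup>2)
      + 2 * ((\<Sum>p\<in>P. \<mu> p *\<^sub>R (p - z)) \<bullet> (z - y))"
    unfolding sum.distrib inner_sum_left by (simp add: sum_distrib_left)
  also have "\<dots> = (norm (z - y))\<^sup>2 + (\<Sum>p\<in>P. \<mu> p * (norm (p - z))\<^sup>2)"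
    unfolding centred by (simp add: sum_distrib_right[symmetric] assms(2))
  also have "(\<Sum>p\<in>P. \<mu> p * (norm (p - z))\<^sup>2) \<le> (\<Sum>p\<in>P. \<mu> p * k\<^sup>2)"
    using assms by (intro sum_mono mult_left_mono power_mono) auto
  also have "\<dots> = k\<^sup>2"
    by (simp add: sum_distrib_right[symmetric] assms(2))
  finally have var: "(\<Sum>p\<in>P. \<mu> p * (norm (p - y))\<^sup>2) \<le> (norm (z - y))\<^sup>2 + k\<^sup>2"
    by simp
  have "(\<Sum>p\<in>P. \<mu> p * sqrt ((norm (p - y))\<^sup>2 + \<eta>)) \<le>
      (\<Sum>p\<in>P. \<mu> p * (((norm (p - y))\<^sup>2 + \<eta> + t) / (2 * sqrt t)))"
  proof (intro sum_mono mult_left_mono)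
    fix p
    define s where "s = (norm (p - y))\<^sup>2 + \<eta>"
    have s: "s \<ge> 0"
      using assms(5) by (simp add: s_def)
    have "2 * sqrt s * sqrt t \<le> s + t"
      using sum_squares_bound[of "sqrt s" "sqrt t"] s t by simp
    then show "sqrt ((norm (p - y))\<^sup>2 + \<eta>) \<le> ((norm (p - y))\<^sup>2 + \<eta> + t) / (2 * sqrt t)"
      using t by (simp add: s_def[symmetric] pos_le_divide_eq mult.commute mult.left_commute)
  qed (use assms in auto)
  also have "\<dots> = ((\<Sum>p\<in>P. \<mu> p * (norm (p - y))\<^sup>2) + \<eta> + t) / (2 * sqrt t)"
  proof -
    have "(\<Sum>p\<in>P. \<mu> p * (((norm (p - y))\<^sup>2 + \<eta> + t) / (2 * sqrt t))) =
       (\<Sum>p\<in>P. \<mu> p * (norm (p - y))\<^sup>2 + \<mu> p * (\<eta> + t)) / (2 * sqrt t)"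
      unfolding sum_divide_distrib by (intro sum.cong) (simp_all add: distrib_left add.assoc)
    then show ?thesis
      by (simp add: sum.distrib sum_distrib_right[symmetric] assms(2))
  qed
  also have "\<dots> \<le> (t + t) / (2 * sqrt t)"
    using var t by (intro divide_right_mono) (auto simp: t_def)
  also have "\<dots> = sqrt t"
    using t real_div_sqrt[of t] by simp
  finally show ?thesis
    by (simp add: t_def)
qed

section \<open>Time discretization\<close>

text \<open>Value iteration from zero, with the operator applied at every point instead of being
  interpolated from the vertices: discrete in time only and truncated after \<open>n\<close>
  steps.\<close>

fun horizon_value where
  "horizon_value lam g f h 0 = (\<lambda>x a. 0 :: real)"
| "horizon_value lam g f h (Suc n) = discrete_operator lam g f h (horizon_value lam g f h n)"

primrec euler :: "('a \<Rightarrow> real \<Rightarrow> 'a) \<Rightarrow> real \<Rightarrow> (nat \<Rightarrow> real) \<Rightarrow> 'a::real_vector \<Rightarrow> nat \<Rightarrow> 'a" where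
  "euler g h c x 0 = x"
| "euler g h c x (Suc n) = euler g h c x n + h *\<^sub>R g (euler g h c x n) (c n)"

lemma euler_shift: "euler g h (\<lambda>n. c (Suc n)) (x + h *\<^sub>R g x (c 0)) n = euler g h c x (Suc n)"
  by (induction n) auto

text \<open>Equality at index 0, not \<open>a \<le> c 0\<close>: in the discrete operator the
  current step is run and charged with \<open>a\<close> itself, and the chosen \<open>b\<close> acts
  from the next step on.\<close>

definition grid_controls :: "real \<Rightarrow> real \<Rightarrow> (nat \<Rightarrow> real) set" where
  "grid_controls h a = {c. c 0 = a \<and> mono c \<and> range c \<subseteq> control_grid h}"

definition euler_cost where
  "euler_cost lam g f h c x n = (\<Sum>i<n. h * (1 - lam * h) ^ i * f (euler g h c x i) (c i))"

lemma euler_cost_Suc: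
  "euler_cost lam g f h c x (Suc n) =
     (1 - lam * h) * euler_cost lam g f h (\<lambda>n. c (Suc n)) (x + h *\<^sub>R g x (c 0)) n + h * f x (c 0)"
proof -
  have "euler_cost lam g f h c x (Suc n) =
      h * f x (c 0) + (\<Sum>i<n. h * (1 - lam * h) ^ Suc i * f (euler g h c x (Suc i)) (c (Suc i)))"
    unfolding euler_cost_def sum.lessThan_Suc_shift by simp
  also have "(\<Sum>i<n. h * (1 - lam * h) ^ Suc i * f (euler g h c x (Suc i)) (c (Suc i))) =
      (1 - lam * h) * euler_cost lam g f h (\<lambda>n. c (Suc n)) (x + h *\<^sub>R g x (c 0)) n"
    unfolding euler_cost_def euler_shift sum_distrib_left by (intro sum.cong) auto
  finally show ?thesis
    by simp
qed

text \<open>Dropping the first entry of a grid control leaves a grid control for its second entry,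
  which is a permitted choice in the minimum. With \<open>horizon_value_attained\<close> this makes
  the truncated value a minimum over whole sequences, the form in which it can be compared with
  controls in continuous time.\<close>

lemma horizon_value_le:
  assumes "h > 0" "lam * h < 1" "c \<in> grid_controls h a"
  shows "horizon_value lam g f h n x a \<le> euler_cost lam g f h c x n"
  using assms(3)
proof (induction n arbitrary: x a c)
  case 0
  then show ?case by (simp add: euler_cost_def)
next
  case (Suc n)
  then have c: "c 0 = a" "mono c" "range c \<subseteq> control_grid h"
    by (auto simp: grid_controls_def)
  have c': "(\<lambda>n. c (Suc n)) \<in> grid_controls h (c 1)"
    using c by (auto simp: grid_controls_def mono_def)
  have "horizon_value lam g f h (Suc n) x a \<le>
      (1 - lam * h) * horizon_value lam g f h n (x + h *\<^sub>R g x a) (c 1) + h * f x a"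
    using assms(1) c by (auto intro!: discrete_operator_le simp: mono_def)
  also have "\<dots> \<le> (1 - lam * h) * euler_cost lam g f h (\<lambda>n. c (Suc n)) (x + h *\<^sub>R g x a) n + h * f x a"
    using Suc.IH[OF c'] assms(2) by (intro add_right_mono mult_left_mono) auto
  finally show ?case
    using euler_cost_Suc[of lam g f h c x n] c(1) by simp
qed

lemma horizon_value_attained:
  assumes "h > 0" "a \<in> control_grid h"
  shows "\<exists>c\<in>grid_controls h a. horizon_value lam g f h n x a = euler_cost lam g f h c x n"
  using assms(2)
proof (induction n arbitrary: x a)
  case 0
  then show ?case
    by (intro bexI[of _ "\<lambda>_. a"]) (auto simp: euler_cost_def grid_controls_def mono_def)
next
  case (Suc n)
  obtain b where b: "b \<in> control_grid h" "a \<le> b"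
    "horizon_value lam g f h (Suc n) x a =
       (1 - lam * h) * horizon_value lam g f h n (x + h *\<^sub>R g x a) b + h * f x a"
    using discrete_operator_attained[OF assms(1) Suc.prems, of lam g f "horizon_value lam g f h n" x]
    by auto
  obtain c where c: "c \<in> grid_controls h b"
    "horizon_value lam g f h n (x + h *\<^sub>R g x a) b = euler_cost lam g f h c (x + h *\<^sub>R g x a) n"
    using Suc.IH[OF b(1)] by blast
  define d where "d = case_nat a c"
  have "d \<in> grid_controls h a"
    using c(1) b(2) Suc.prems
    by (auto simp: d_def grid_controls_def mono_iff_le_Suc image_subset_iff split: nat.splits)
  moreover have "horizon_value lam g f h (Suc n) x a = euler_cost lam g f h d x (Suc n)"
    unfolding euler_cost_Suc b(3) c(2) by (simp add: d_def)
  ultimately show ?case by blast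
qed

section \<open>The fully discrete solution against the time-discrete value\<close>

locale control_problem =
  fixes \<Omega> :: "'a::euclidean_space set" and g :: "'a \<Rightarrow> real \<Rightarrow> 'a" and f :: "'a \<Rightarrow> real \<Rightarrow> real"
    and lam Lg Mg Lf Mf h :: real
  assumes pos: "lam > 0" "Lg > 0" "Mg > 0" "Lf > 0" "Mf > 0" "h > 0"
    and lam_h: "lam * h < 1"
    and lip_g: "lipschitz_bounded \<Omega> Lg Mg g" and lip_f: "lipschitz_bounded \<Omega> Lf Mf f"
begin

abbreviation "q \<equiv> 1 - lam * h"
abbreviation "\<rho> \<equiv> 1 + h * Lg"

lemma grid_unit: "a \<in> control_grid h \<Longrightarrow> a \<in> {0..1}"
  using control_grid_subset[OF pos(6)] by blast

lemma q_bounds: "0 < q" "q < 1"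
  using pos lam_h by auto

end

locale discretization = control_problem \<Omega> g f lam Lg Mg Lf Mf h
  for \<Omega> :: "'a::euclidean_space set" and g f lam Lg Mg Lf Mf h +
  fixes \<T> :: "'a set set" and k :: real and w :: "'a \<Rightarrow> real \<Rightarrow> real"
  assumes k_pos: "k > 0"
    and tri: "triangulation \<T>" and size: "Max (diameter ` \<T>) = k"
    and sub: "\<Union>\<T> \<subseteq> \<Omega>"
    and inv: "\<And>x a. x \<in> \<Union>\<T> \<Longrightarrow> a \<in> control_grid h \<Longrightarrow> x + h *\<^sub>R g x a \<in> \<Union>\<T>"
    and sol: "discrete_solution lam g f \<T> h w"
begin

lemma w_fe: "w \<in> fe_space \<T> h"
  using sol by (simp add: discrete_solution_def)

lemma vertex_Union: "x \<in> mesh_vertices \<T> \<Longrightarrow> x \<in> \<Union>\<T>"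
  using mesh_vertices_subset by blast

lemma fixed_point:
  "x \<in> mesh_vertices \<T> \<Longrightarrow> a \<in> control_grid h \<Longrightarrow> w x a = discrete_operator lam g f h w x a"
  using sol by (simp add: discrete_solution_def)

lemma interpolated_bound:
  assumes "z \<in> \<Union>\<T>" "a \<in> control_grid h" "\<And>x. x \<in> mesh_vertices \<T> \<Longrightarrow> \<bar>w x a - c\<bar> \<le> B"
  shows "\<bar>w z a - c\<bar> \<le> B"
proof -
  obtain P \<mu> where interp: "P \<subseteq> mesh_vertices \<T>" "\<forall>p\<in>P. 0 \<le> \<mu> p" "sum \<mu> P = 1"
    "(\<Sum>p\<in>P. \<mu> p *\<^sub>R p) = z" "\<forall>p\<in>P. norm (p - z) \<le> k"
    "\<forall>a\<in>control_grid h. w z a = (\<Sum>p\<in>P. \<mu> p * w p a)"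
    using mesh_interpolation[OF tri size assms(1) w_fe] .
  note P = interp(1) interp(2)[rule_format] interp(3,4) interp(5)[rule_format] and w = interp(6)[rule_format]
  have "\<bar>(\<Sum>p\<in>P. \<mu> p * w p a) - c\<bar> \<le> (\<Sum>p\<in>P. \<mu> p * B)"
    using P(1) by (intro convex_combination_diff_le[OF P(2,3)] assms(3)) blast+
  then show ?thesis
    using w[OF assms(2)] P(3) by (simp add: sum_distrib_right[symmetric])
qed

text \<open>Interpolated values do not exceed the vertex maximum \<open>M\<close> in modulus, so
  \<open>M \<le> q * M + h * Mf\<close>, and \<open>1 - q = lam * h\<close>. The bound controls what
  is left of \<open>w\<close> when the comparison stops at a finite horizon.\<close>

lemma discrete_solution_bound:
  assumes "x \<in> mesh_vertices \<T>" "a \<in> control_grid h"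
  shows "\<bar>w x a\<bar> \<le> Mf / lam"
proof -
  define X where "X = (\<lambda>(x, a). \<bar>w x a\<bar>) ` (mesh_vertices \<T> \<times> control_grid h)"
  have fin: "finite X"
    unfolding X_def by (intro finite_imageI finite_cartesian_product finite_mesh_vertices
      finite_control_grid tri pos)
  have le: "\<bar>w x a\<bar> \<le> Max X" if "x \<in> mesh_vertices \<T>" "a \<in> control_grid h" for x a
    using that by (intro Max_ge fin) (force simp: X_def)
  have "\<bar>w x a\<bar> \<le> q * Max X + h * Mf" if x: "x \<in> mesh_vertices \<T>" and a: "a \<in> control_grid h" for x a
  proof -
    obtain b where b: "b \<in> control_grid h"
      "discrete_operator lam g f h w x a = q * w (x + h *\<^sub>R g x a) b + h * f x a"
      using discrete_operator_attained[OF pos(6) a] by metis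
    have "\<bar>w (x + h *\<^sub>R g x a) b - 0\<bar> \<le> Max X"
      using le[OF _ b(1)] by (intro interpolated_bound[OF inv[OF vertex_Union[OF x] a] b(1)]) simp
    then have "q * \<bar>w (x + h *\<^sub>R g x a) b\<bar> \<le> q * Max X"
      using q_bounds by (intro mult_left_mono) auto
    moreover have "\<bar>f x a\<bar> \<le> Mf"
      using lipschitz_bounded_normD[OF lip_f _ grid_unit[OF a]] sub vertex_Union[OF x] by auto
    then have "h * \<bar>f x a\<bar> \<le> h * Mf"
      using pos by (intro mult_left_mono) auto
    moreover have "\<bar>w x a\<bar> \<le> q * \<bar>w (x + h *\<^sub>R g x a) b\<bar> + h * \<bar>f x a\<bar>"
      using abs_triangle_ineq[of "q * w (x + h *\<^sub>R g x a) b" "h * f x a"] q_bounds pos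
      unfolding fixed_point[OF x a] b(2) by (simp add: abs_mult)
    ultimately show ?thesis by linarith
  qed
  moreover have "X \<noteq> {}"
    using assms by (auto simp: X_def)
  ultimately have "Max X \<le> q * Max X + h * Mf"
    using Max_in[OF fin] by (auto simp: X_def)
  then have "h * (lam * Max X) \<le> h * Mf"
    by (simp add: algebra_simps)
  then have "Max X \<le> Mf / lam"
    using pos by (simp add: field_simps)
  with le[OF assms] show ?thesis by simp
qed

text \<open>Chosen so that \<open>k\<^sup>2 = 2 * h * Lg * \<eta>\<close>. Then
  \<open>k\<^sup>2 + \<eta> \<le> \<rho>\<^sup>2 * \<eta>\<close>: the variance of one interpolation
  is absorbed by the growth that the Lipschitz constant of \<open>g\<close> causes anyway.\<close>

definition \<eta> where "\<eta> = k\<^sup>2 / (2 * h * Lg)"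

lemma \<eta>_pos: "\<eta> > 0"
  using pos k_pos by (simp add: \<eta>_def)

text \<open>Both solutions choose their next control at the same time, so this is an induction on dynamic
  programming equations. The function \<open>\<lambda>d. sqrt (d\<^sup>2 + \<eta>)\<close> is preserved, up to the factor \<open>\<rho>\<close>, by an
  Euler step followed by interpolation; \<open>\<eta>\<close> is of order \<open>k\<^sup>2 / h\<close>, which is the gain over the naive \<open>(k / h)\<^sup>2\<close>.\<close>

lemma vertex_horizon_error:
  assumes "x \<in> mesh_vertices \<T>" "y \<in> \<Union>\<T>" "a \<in> control_grid h"
  shows "\<bar>w x a - horizon_value lam g f h n y a\<bar> \<le>
    h * Lf * (\<Sum>i<n. (q * \<rho>) ^ i) * sqrt ((norm (x - y))\<^sup>2 + \<eta>) + q ^ n * (Mf / lam)"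
  using assms
proof (induction n arbitrary: x y a)
  case 0
  then show ?case using discrete_solution_bound by simp
next
  case (Suc n)
  note x = Suc.prems(1) and y = Suc.prems(2) and a = Suc.prems(3)
  define K where "K = h * Lf * (\<Sum>i<n. (q * \<rho>) ^ i)"
  define s where "s = sqrt ((norm (x - y))\<^sup>2 + \<eta>)"
  define x' where "x' = x + h *\<^sub>R g x a"
  define y' where "y' = y + h *\<^sub>R g y a"
  have K: "K \<ge> 0"
    unfolding K_def using pos q_bounds by (intro mult_nonneg_nonneg sum_nonneg zero_le_power) auto
  have x'y': "x' \<in> \<Union>\<T>" "y' \<in> \<Union>\<T>"
    unfolding x'_def y'_def using x y a inv vertex_Union by blast+
  have xy\<Omega>: "x \<in> \<Omega>" "y \<in> \<Omega>"
    using x y sub vertex_Union by blast+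
  have "norm (x' - y') \<le> norm (x - y) + norm (h *\<^sub>R (g x a - g y a))"
    unfolding x'_def y'_def by (rule order_trans[OF _ norm_triangle_ineq]) (simp add: algebra_simps)
  also have "\<dots> \<le> norm (x - y) + h * (Lg * (norm (x - y) + \<bar>a - a\<bar>))"
    using lipschitz_boundedD[OF lip_g xy\<Omega> grid_unit[OF a] grid_unit[OF a]] pos
    by (simp add: mult_left_mono)
  also have "\<dots> = \<rho> * norm (x - y)"
    by (simp add: algebra_simps)
  finally have d: "norm (x' - y') \<le> \<rho> * norm (x - y)" .
  have "(norm (x' - y'))\<^sup>2 + k\<^sup>2 + \<eta> \<le> (\<rho> * norm (x - y))\<^sup>2 + 2 * h * Lg * \<eta> + \<eta>"
    using power_mono[OF d, of 2] pos by (simp add: \<eta>_def)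
  also have "(\<rho> * norm (x - y))\<^sup>2 + 2 * h * Lg * \<eta> + \<eta> = \<rho>\<^sup>2 * ((norm (x - y))\<^sup>2 + \<eta>) - (h * Lg)\<^sup>2 * \<eta>"
    by (simp add: power2_eq_square algebra_simps)
  also have "\<dots> \<le> \<rho>\<^sup>2 * ((norm (x - y))\<^sup>2 + \<eta>)"
    using \<eta>_pos by simp
  finally have "sqrt ((norm (x' - y'))\<^sup>2 + k\<^sup>2 + \<eta>) \<le> sqrt (\<rho>\<^sup>2 * ((norm (x - y))\<^sup>2 + \<eta>))"
    by (rule real_sqrt_le_mono)
  also have "\<dots> = \<rho> * s"
    using pos by (simp add: s_def real_sqrt_mult)
  finally have step: "sqrt ((norm (x' - y'))\<^sup>2 + k\<^sup>2 + \<eta>) \<le> \<rho> * s" .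
  have "h * \<bar>f x a - f y a\<bar> \<le> h * (Lf * s)"
  proof -
    have "norm (x - y) \<le> s"
      unfolding s_def using \<eta>_pos by (intro real_le_rsqrt) simp
    then have "Lf * norm (x - y) \<le> Lf * s"
      using pos by (intro mult_left_mono) auto
    moreover have "\<bar>f x a - f y a\<bar> \<le> Lf * norm (x - y)"
      using lipschitz_boundedD[OF lip_f xy\<Omega> grid_unit[OF a] grid_unit[OF a]] by simp
    ultimately have "\<bar>f x a - f y a\<bar> \<le> Lf * s"
      by linarith
    then show ?thesis
      using pos by (intro mult_left_mono) auto
  qed
  note fdiff = this
  obtain P \<mu> where interp: "P \<subseteq> mesh_vertices \<T>" "\<forall>p\<in>P. 0 \<le> \<mu> p" "sum \<mu> P = 1"
    "(\<Sum>p\<in>P. \<mu> p *\<^sub>R p) = x'" "\<forall>p\<in>P. norm (p - x') \<le> k"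
    "\<forall>a\<in>control_grid h. w x' a = (\<Sum>p\<in>P. \<mu> p * w p a)"
    using mesh_interpolation[OF tri size x'y'(1) w_fe] .
  note P = interp(1) interp(2)[rule_format] interp(3,4) interp(5)[rule_format] and w = interp(6)[rule_format]
  have "\<bar>w x a - horizon_value lam g f h (Suc n) y a\<bar> \<le> q * (K * (\<rho> * s) + q ^ n * (Mf / lam)) + h * (Lf * s)"
    unfolding fixed_point[OF x a] horizon_value.simps
  proof (rule discrete_operator_diff_le[OF pos(6) a], fold x'_def y'_def)
    fix b assume b: "b \<in> control_grid h"
    let ?v = "horizon_value lam g f h n y' b"
    have "\<bar>w x' b - ?v\<bar> \<le> (\<Sum>p\<in>P. \<mu> p * (K * sqrt ((norm (p - y'))\<^sup>2 + \<eta>) + q ^ n * (Mf / lam)))"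
      unfolding w[OF b] K_def using P(1)
      by (intro convex_combination_diff_le[OF P(2,3)] Suc.IH[OF _ x'y'(2) b]) blast+
    also have "\<dots> = K * (\<Sum>p\<in>P. \<mu> p * sqrt ((norm (p - y'))\<^sup>2 + \<eta>)) + (\<Sum>p\<in>P. \<mu> p) * (q ^ n * (Mf / lam))"
      unfolding distrib_left sum.distrib sum_distrib_left sum_distrib_right
      by (simp only: mult.left_commute)
    also have "\<dots> \<le> K * (\<rho> * s) + q ^ n * (Mf / lam)"
      using mult_left_mono[OF order_trans[OF sum_sqrt_barycentre_le[OF P(2,3,4,5) \<eta>_pos] step] K] P(3) by simp
    finally have "q * \<bar>w x' b - ?v\<bar> \<le> q * (K * (\<rho> * s) + q ^ n * (Mf / lam))"
      using q_bounds by (intro mult_left_mono) auto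
    moreover have "\<bar>(q * w x' b + h * f x a) - (q * ?v + h * f y a)\<bar> \<le> q * \<bar>w x' b - ?v\<bar> + h * \<bar>f x a - f y a\<bar>"
    proof -
      have "(q * w x' b + h * f x a) - (q * ?v + h * f y a) = q * (w x' b - ?v) + h * (f x a - f y a)"
        by (simp add: algebra_simps)
      also have "\<bar>\<dots>\<bar> \<le> \<bar>q * (w x' b - ?v)\<bar> + \<bar>h * (f x a - f y a)\<bar>"
        by (rule abs_triangle_ineq)
      also have "\<dots> = q * \<bar>w x' b - ?v\<bar> + h * \<bar>f x a - f y a\<bar>"
        using q_bounds pos by (simp add: abs_mult)
      finally show ?thesis .
    qed
    ultimately show "\<bar>(q * w x' b + h * f x a) - (q * ?v + h * f y a)\<bar>
        \<le> q * (K * (\<rho> * s) + q ^ n * (Mf / lam)) + h * (Lf * s)"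
      using fdiff by linarith
  qed
  also have "\<dots> = (h * Lf + q * \<rho> * K) * s + q ^ Suc n * (Mf / lam)"
  proof -
    have "c * (K * (r * s) + c ^ n * m) + h * (Lf * s) = (h * Lf + c * r * K) * s + c ^ Suc n * m" for c r m
      by (simp add: algebra_simps)
    then show ?thesis .
  qed
  \<comment> \<open>Iterating \<open>K \<mapsto> h * Lf + q * \<rho> * K\<close> from zero generates
    the geometric sum.\<close>
  also have "h * Lf + q * \<rho> * K = h * Lf * (\<Sum>i<Suc n. (q * \<rho>) ^ i)"
    unfolding K_def sum.lessThan_Suc_shift sum_distrib_left distrib_left by (simp add: mult_ac)
  finally show ?case
    by (simp only: s_def)
qed

text \<open>The fixed-point equation is available at vertices only, so a general \<open>x\<close> is
  spread over the vertices of its cell. Each starts at distance at most \<open>k\<close> from the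
  Euler path; this adds \<open>k\<^sup>2\<close> under the root and leaves the order unchanged,
  since \<open>\<eta>\<close> is of order \<open>k\<^sup>2 / h\<close>.\<close>

lemma horizon_error:
  assumes "x \<in> \<Union>\<T>" "a \<in> control_grid h"
  shows "\<bar>w x a - horizon_value lam g f h n x a\<bar> \<le>
    h * Lf * (\<Sum>i<n. (q * \<rho>) ^ i) * sqrt (k\<^sup>2 + \<eta>) + q ^ n * (Mf / lam)"
proof -
  obtain P \<mu> where interp: "P \<subseteq> mesh_vertices \<T>" "\<forall>p\<in>P. 0 \<le> \<mu> p" "sum \<mu> P = 1"
    "(\<Sum>p\<in>P. \<mu> p *\<^sub>R p) = x" "\<forall>p\<in>P. norm (p - x) \<le> k"
    "\<forall>a\<in>control_grid h. w x a = (\<Sum>p\<in>P. \<mu> p * w p a)"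
    using mesh_interpolation[OF tri size assms(1) w_fe] .
  note P = interp(1) interp(2)[rule_format] interp(3,4) interp(5)[rule_format] and w = interp(6)[rule_format]
  let ?v = "horizon_value lam g f h n x a"
  let ?B = "h * Lf * (\<Sum>i<n. (q * \<rho>) ^ i) * sqrt (k\<^sup>2 + \<eta>) + q ^ n * (Mf / lam)"
  have "\<bar>w x a - ?v\<bar> \<le> (\<Sum>p\<in>P. \<mu> p * ?B)"
    unfolding w[OF assms(2)]
  proof (rule convex_combination_diff_le[OF P(2,3)])
    fix p assume p: "p \<in> P"
    have "\<bar>w p a - ?v\<bar> \<le>
        h * Lf * (\<Sum>i<n. (q * \<rho>) ^ i) * sqrt ((norm (p - x))\<^sup>2 + \<eta>) + q ^ n * (Mf / lam)"
      using P(1) p by (intro vertex_horizon_error[OF _ assms]) auto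
    also have "\<dots> \<le> ?B"
      using P(5)[OF p] pos q_bounds
      by (intro add_right_mono mult_left_mono real_sqrt_le_mono power_mono mult_nonneg_nonneg
        sum_nonneg zero_le_power) auto
    finally show "\<bar>w p a - ?v\<bar> \<le> ?B" .
  qed
  also have "\<dots> = ?B"
    unfolding sum_distrib_right[symmetric] P(3) by simp
  finally show ?thesis .
qed

end

section \<open>Trajectories and Euler paths\<close>

lemma trajectory_increment:
  assumes "trajectory \<Omega> g x \<alpha> y" "0 \<le> s" "s \<le> t"
  shows "((\<lambda>r. g (y r) (\<alpha> r)) has_integral (y t - y s)) {s..t}"
proof -
  have s: "((\<lambda>r. g (y r) (\<alpha> r)) has_integral (y s - x)) {0..s}"
    and t: "((\<lambda>r. g (y r) (\<alpha> r)) has_integral (y t - x)) {0..t}"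
    using assms unfolding trajectory_def by auto
  have int: "(\<lambda>r. g (y r) (\<alpha> r)) integrable_on {0..t}"
    using t by blast
  have "(\<lambda>r. g (y r) (\<alpha> r)) integrable_on {s..t}"
    by (rule integrable_subinterval_real[OF int]) (use assms in auto)
  moreover have "integral {s..t} (\<lambda>r. g (y r) (\<alpha> r)) = y t - y s"
    using Henstock_Kurzweil_Integration.integral_combine[OF assms(2,3) int]
      integral_unique[OF s] integral_unique[OF t] by (simp add: algebra_simps)
  ultimately show ?thesis
    by (metis integrable_integral)
qed

text \<open>The hypothesis omits the right endpoint, where a step control already takes its next
  value; a single point does not affect the integral.\<close>

lemma has_integral_near_constant:
  fixes F :: "real \<Rightarrow> 'b::euclidean_space"
  assumes "(F has_integral I) {s..t}" "s \<le> t" "B \<ge> 0"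
    and "\<And>r. s \<le> r \<Longrightarrow> r < t \<Longrightarrow> norm (F r - G) \<le> B"
  shows "norm (I - (t - s) *\<^sub>R G) \<le> (t - s) * B"
proof -
  have "((\<lambda>r. F r - G) has_integral (I - (t - s) *\<^sub>R G)) {s..t}"
    using has_integral_diff[OF assms(1) has_integral_const_real[of G s t]] assms(2) by simp
  from has_integral_bound_real[OF assms(3) _ this, of "{t}"] assms(2,4)
  show ?thesis
    by (simp add: mult.commute)
qed

lemma controls_unit:
  assumes "\<alpha> \<in> controls a" "s \<ge> 0"
  shows "\<alpha> s \<in> {0..1}"
  using assms by (auto simp: controls_def image_subset_iff)

context control_problem
begin

lemma trajectory_speed:
  assumes "\<alpha> \<in> controls a" "trajectory \<Omega> g x \<alpha> y" "0 \<le> s" "s \<le> t"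
  shows "norm (y t - y s) \<le> (t - s) * Mg"
proof -
  have "norm (g (y r) (\<alpha> r) - 0) \<le> Mg" if "s \<le> r" for r
    using that assms controls_unit[OF assms(1)]
    by (auto simp: trajectory_def intro!: lipschitz_bounded_normD[OF lip_g])
  then show ?thesis
    using has_integral_near_constant[OF trajectory_increment[OF assms(2-4)] assms(4), of Mg 0] pos
    by simp
qed

text \<open>A discrete Gronwall inequality. Within a step the trajectory moves by at most
  \<open>Mg * h\<close> and the control is off by at most \<open>h + v n\<close>; since
  \<open>h * Lg = \<rho> - 1\<close>, the last term of the bound solves the recursion driven by
  \<open>(Mg + 1) * h\<close> exactly. The \<open>v n\<close> need not be small: they enter with
  weight \<open>h * Lg\<close>, so only their sum matters and a jump costs order
  \<open>h\<close>.\<close>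

lemma trajectory_euler_error:
  assumes \<alpha>: "\<alpha> \<in> controls a" and y: "trajectory \<Omega> g x \<alpha> y"
    and c: "\<And>n. c n \<in> {0..1}" and p: "\<And>n. euler g h c x n \<in> \<Omega>"
    and v: "\<And>n. v n \<ge> 0"
    and near: "\<And>n s. real n * h \<le> s \<Longrightarrow> s < real (Suc n) * h \<Longrightarrow> \<bar>\<alpha> s - c n\<bar> \<le> h + v n"
  shows "norm (y (real m * h) - euler g h c x m) \<le>
    \<rho> ^ m * (h * Lg * (\<Sum>n<m. v n)) + (\<rho> ^ m - 1) * ((Mg + 1) * h)"
proof (induction m)
  case 0
  then show ?case using y by (simp add: trajectory_def)
next
  case (Suc m)
  define D where "D = norm (y (real m * h) - euler g h c x m)"
  let ?p = "euler g h c x m" and ?s = "real m * h" and ?t = "real (Suc m) * h"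
  let ?V = "\<Sum>n<m. v n"
  have st: "0 \<le> ?s" "?s \<le> ?t" "?t - ?s = h"
    using pos by (auto simp: algebra_simps)
  have "norm (g (y r) (\<alpha> r) - g ?p (c m)) \<le> Lg * (D + (Mg + 1) * h + v m)"
    if r: "?s \<le> r" "r < ?t" for r
  proof -
    have r0: "r \<ge> 0"
      using r st(1) by linarith
    have "norm (y r - y ?s) \<le> (r - ?s) * Mg"
      using trajectory_speed[OF \<alpha> y st(1) r(1)] .
    also have "\<dots> \<le> h * Mg"
      using pos r st by (intro mult_right_mono) auto
    finally have "norm (y r - ?p) \<le> h * Mg + D"
      using norm_triangle_ineq[of "y r - y ?s" "y ?s - ?p"] by (simp add: D_def)
    moreover have "\<bar>\<alpha> r - c m\<bar> \<le> h + v m"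
      using near r by simp
    moreover have "norm (g (y r) (\<alpha> r) - g ?p (c m)) \<le> Lg * (norm (y r - ?p) + \<bar>\<alpha> r - c m\<bar>)"
      using y r0 by (intro lipschitz_boundedD[OF lip_g _ p controls_unit[OF \<alpha> r0] c])
        (simp add: trajectory_def)
    moreover have "Lg * (norm (y r - ?p) + \<bar>\<alpha> r - c m\<bar>) \<le> Lg * (D + (Mg + 1) * h + v m)"
      using calculation(1,2) pos by (intro mult_left_mono) (auto simp: algebra_simps)
    ultimately show ?thesis by linarith
  qed
  then have "norm (y ?t - y ?s - (?t - ?s) *\<^sub>R g ?p (c m)) \<le> (?t - ?s) * (Lg * (D + (Mg + 1) * h + v m))"
    using pos v[of m] by (intro has_integral_near_constant[OF trajectory_increment[OF y st(1,2)] st(2)])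
      (auto simp: D_def)
  then have step: "norm (y ?t - y ?s - h *\<^sub>R g ?p (c m)) \<le> h * (Lg * (D + (Mg + 1) * h + v m))"
    unfolding st(3) .
  have "norm (y ?t - euler g h c x (Suc m)) \<le> norm (y ?s - ?p) + norm (y ?t - y ?s - h *\<^sub>R g ?p (c m))"
    using norm_triangle_ineq[of "y ?s - ?p" "y ?t - y ?s - h *\<^sub>R g ?p (c m)"] by (simp add: algebra_simps)
  also have "\<dots> \<le> D + h * (Lg * (D + (Mg + 1) * h + v m))"
    using step by (simp add: D_def)
  also have "\<dots> = \<rho> * D + h * Lg * ((Mg + 1) * h) + h * Lg * v m"
    by (simp add: algebra_simps)
  \<comment> \<open>The new term \<open>h * Lg * v m\<close> is enlarged by
    \<open>\<rho> ^ Suc m\<close>, so that all terms in \<open>v\<close> share one factor.\<close>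
  also have "\<dots> \<le> \<rho> * (\<rho> ^ m * (h * Lg * ?V) + (\<rho> ^ m - 1) * ((Mg + 1) * h))
      + h * Lg * ((Mg + 1) * h) + \<rho> ^ Suc m * (h * Lg * v m)"
  proof (intro add_mono mult_left_mono order_refl)
    show "D \<le> \<rho> ^ m * (h * Lg * ?V) + (\<rho> ^ m - 1) * ((Mg + 1) * h)"
      using Suc.IH by (simp add: D_def)
    have "1 \<le> \<rho> ^ Suc m"
      using pos by (intro one_le_power) simp
    then have "1 * (h * Lg * v m) \<le> \<rho> ^ Suc m * (h * Lg * v m)"
      using pos v[of m] by (intro mult_right_mono) auto
    then show "h * Lg * v m \<le> \<rho> ^ Suc m * (h * Lg * v m)"
      by simp
  qed (use pos in auto)
  also have "\<dots> = \<rho> ^ Suc m * (h * Lg * (\<Sum>n<Suc m. v n)) + (\<rho> ^ Suc m - 1) * ((Mg + 1) * h)"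
  proof -
    have "r * (R * (h * Lg * V) + (R - 1) * M) + (r - 1) * M + r * R * (h * Lg * u)
        = r * R * (h * Lg * (V + u)) + (r * R - 1) * M" for r R V M u :: real
      by (simp add: algebra_simps)
    from this[of \<rho> "\<rho> ^ m" ?V "(Mg + 1) * h" "v m"] show ?thesis
      by simp
  qed
  finally show ?case .
qed

section \<open>Comparison of costs\<close>

lemma trajectory_continuous:
  assumes "\<alpha> \<in> controls a" "trajectory \<Omega> g x \<alpha> y"
  shows "continuous_on {0..} y"
proof (rule lipschitz_on_continuous_on[of Mg], rule lipschitz_onI)
  fix s t :: real assume "s \<in> {0..}" "t \<in> {0..}"
  then show "dist (y s) (y t) \<le> Mg * dist s t"
    using trajectory_speed[OF assms, of s t] trajectory_speed[OF assms, of t s]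
    by (cases "s \<le> t") (auto simp: dist_norm norm_minus_commute mult.commute abs_if)
qed (use pos in simp)

text \<open>A monotone control is Borel and a trajectory is continuous, so composing with the
  jointly continuous \<open>f\<close> gives measurability, and \<open>Mf * exp (- lam * s)\<close>
  dominates. Absolute integrability passes to the cells and tails into which the half-line is
  cut.\<close>

lemma cost_absolutely_integrable:
  assumes "\<alpha> \<in> controls a" "trajectory \<Omega> g x \<alpha> y"
  shows "(\<lambda>s. f (y s) (\<alpha> s) * exp (- lam * s)) absolutely_integrable_on {0..}"
proof (rule measurable_bounded_by_integrable_imp_absolutely_integrable)
  have "continuous_on (\<Omega> \<times> {0..1}) (\<lambda>(z, b). f z b)"
  proof (rule lipschitz_on_continuous_on[of "2 * Lf"], rule lipschitz_onI)
    fix u v :: "'a \<times> real" assume "u \<in> \<Omega> \<times> {0..1}" "v \<in> \<Omega> \<times> {0..1}"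
    then have "norm (f (fst u) (snd u) - f (fst v) (snd v)) \<le> Lf * (norm (fst u - fst v) + \<bar>snd u - snd v\<bar>)"
      by (intro lipschitz_boundedD[OF lip_f]) auto
    also have "\<dots> \<le> Lf * (dist u v + dist u v)"
      using pos dist_fst_le[of u v] dist_snd_le[of u v]
      by (intro mult_left_mono add_mono) (auto simp: dist_norm)
    finally show "dist (case u of (z, b) \<Rightarrow> f z b) (case v of (z, b) \<Rightarrow> f z b) \<le> 2 * Lf * dist u v"
      by (simp add: dist_norm case_prod_unfold)
  qed (use pos in simp)
  then have f: "(\<lambda>(z, b). f z b) \<in> borel_measurable (restrict_space borel (\<Omega> \<times> {0..1}))"
    by (rule borel_measurable_continuous_on_restrict)
  have "y \<in> borel_measurable (restrict_space borel {0..})"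
    using trajectory_continuous[OF assms] by (rule borel_measurable_continuous_on_restrict)
  moreover have "\<alpha> \<in> borel_measurable (restrict_space borel {0..})"
    using assms(1) by (intro borel_measurable_mono_on_fnc) (simp add: controls_def)
  ultimately have "(\<lambda>s. (y s, \<alpha> s)) \<in> borel_measurable (restrict_space borel {0..})"
    by (rule borel_measurable_Pair)
  moreover have "(\<lambda>s. (y s, \<alpha> s)) ` {0..} \<subseteq> \<Omega> \<times> {0..1}"
    using assms(2) controls_unit[OF assms(1)] by (auto simp: trajectory_def)
  ultimately have "(\<lambda>s. (y s, \<alpha> s)) \<in> restrict_space borel {0..} \<rightarrow>\<^sub>M restrict_space borel (\<Omega> \<times> {0..1})"
    by (intro measurable_restrict_space2) (auto simp: space_restrict_space)
  from measurable_comp[OF this f]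
  have "(\<lambda>s. f (y s) (\<alpha> s)) \<in> borel_measurable (restrict_space borel {0..})"
    by (simp add: comp_def)
  then have "(\<lambda>s. f (y s) (\<alpha> s) * exp (- lam * s)) \<in> borel_measurable (restrict_space borel {0..})"
    by (rule borel_measurable_times[OF _ borel_measurable_continuous_on_restrict])
      (intro continuous_intros)
  then show "(\<lambda>s. f (y s) (\<alpha> s) * exp (- lam * s)) \<in> borel_measurable (lebesgue_on {0..})"
    by (rule borel_measurable_subalgebra[rotated 2])
      (auto intro!: mono_restrict_space simp: space_restrict_space)
  show "(\<lambda>s. Mf * exp (- lam * s)) integrable_on {0..}"
    by (rule has_integral_integrable[OF has_integral_mult_right[OF has_integral_exp_minus_to_infinity]])
      (rule pos)
  show "norm (f (y s) (\<alpha> s) * exp (- lam * s)) \<le> Mf * exp (- lam * s)" if "s \<in> {0..}" for s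
  proof -
    have "norm (f (y s) (\<alpha> s)) \<le> Mf"
      using that assms(2) controls_unit[OF assms(1), of s]
      by (intro lipschitz_bounded_normD[OF lip_f]) (auto simp: trajectory_def)
    then show ?thesis
      by (simp add: abs_mult mult_right_mono)
  qed
qed auto

end

text \<open>The left side is the left Riemann sum of \<open>exp (- lam * s)\<close> on the
  half-line. The function decreases from 1, so the sum exceeds the integral \<open>1 / lam\<close>
  by at most one step.\<close>

lemma step_over_decay:
  fixes lam h :: real
  assumes "lam > 0" "h > 0"
  shows "h / (1 - exp (- lam * h)) \<le> 1 / lam + h"
proof -
  have "1 + lam * h \<le> exp (lam * h)"
    by simp
  then have "(1 + lam * h) * exp (- lam * h) \<le> exp (lam * h) * exp (- lam * h)"
    by (intro mult_right_mono) auto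
  also have "\<dots> = 1"
    by (simp flip: exp_add)
  finally have "h * lam \<le> (1 + lam * h) * (1 - exp (- lam * h))"
    by (simp add: algebra_simps)
  then have "h \<le> (1 / lam + h) * (1 - exp (- lam * h))"
    using assms by (simp add: field_simps)
  moreover have "exp (- lam * h) < 1"
    using assms by simp
  ultimately show ?thesis
    by (simp add: pos_divide_le_eq)
qed

section \<open>Discounting and the cost of a single control\<close>

context control_problem
begin

abbreviation "E \<equiv> exp (- lam * h)"

lemma exp_power: "E ^ n = exp (- lam * (real n * h))"
  by (simp add: exp_of_nat_mult[symmetric] mult_ac)

lemma q_le_E: "q \<le> E"
  using exp_ge_add_one_self[of "- lam * h"] by simp

lemma E_bounds: "0 < E" "E < 1"
  using pos by auto

lemma sum_E_eq: "(\<Sum>n<N. h * E ^ n) = (1 - E ^ N) * (h / (1 - E))"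
  using pos by (simp add: sum_distrib_left[symmetric] sum_gp_strict)

lemma sum_E_le: "(\<Sum>n<N. h * E ^ n) \<le> 1 / lam + h"
proof -
  have "(1 - E ^ N) * (h / (1 - E)) \<le> 1 * (h / (1 - E))"
    using E_bounds pos by (intro mult_right_mono) auto
  then show ?thesis
    unfolding sum_E_eq using step_over_decay[OF pos(1,6)] by simp
qed

text \<open>Both sums are geometric: \<open>h / (1 - q)\<close> is exactly \<open>1 / lam\<close>,
  and \<open>h / (1 - E)\<close> is at most \<open>1 / lam + h\<close>. As \<open>q \<le> E\<close>,
  the factors \<open>1 - E ^ N\<close> and \<open>1 - q ^ N\<close> are ordered favourably, and the
  bound is uniform in \<open>N\<close>.\<close>

lemma sum_E_minus_q_le: "(\<Sum>n<N. h * (E ^ n - q ^ n)) \<le> h"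
proof -
  have "(\<Sum>n<N. h * q ^ n) = (1 - q ^ N) / lam"
    using q_bounds pos by (simp add: sum_distrib_left[symmetric] sum_gp_strict field_simps)
  moreover have "(\<Sum>n<N. h * E ^ n) \<le> (1 - E ^ N) * (1 / lam + h)"
    unfolding sum_E_eq using E_bounds step_over_decay[OF pos(1,6)]
    by (intro mult_left_mono) (auto simp: power_le_one)
  moreover have "(1 - E ^ N) * (1 / lam + h) = (1 - E ^ N) / lam + (1 - E ^ N) * h"
    by (simp add: distrib_left)
  moreover have "(1 - E ^ N) * h \<le> 1 * h"
    using pos by (intro mult_right_mono) auto
  moreover have "(1 - E ^ N) / lam \<le> (1 - q ^ N) / lam"
    using pos q_bounds by (intro divide_right_mono diff_left_mono power_mono q_le_E) auto
  ultimately show ?thesis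
    by (simp add: right_diff_distrib sum_subtractf)
qed

lemma cost_bound:
  assumes "\<alpha> \<in> controls a" "trajectory \<Omega> g x \<alpha> y" "s \<ge> 0"
  shows "\<bar>f (y s) (\<alpha> s)\<bar> \<le> Mf"
  using assms lipschitz_bounded_normD[OF lip_f _ controls_unit[OF assms(1,3)]]
  by (simp add: trajectory_def)

lemma cost_integrable:
  assumes "\<alpha> \<in> controls a" "trajectory \<Omega> g x \<alpha> y" "S \<subseteq> {0..}" "S \<in> sets lebesgue"
  shows "(\<lambda>s. f (y s) (\<alpha> s) * exp (- lam * s)) integrable_on S"
  using set_integrable_subset[OF cost_absolutely_integrable[OF assms(1,2)] assms(4,3)]
  by (rule set_lebesgue_integral_eq_integral(1))

lemma cost_tail:
  assumes "\<alpha> \<in> controls a" "trajectory \<Omega> g x \<alpha> y" "t \<ge> 0"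
  shows "\<bar>integral {t..} (\<lambda>s. f (y s) (\<alpha> s) * exp (- lam * s))\<bar> \<le> Mf / lam * exp (- lam * t)"
proof -
  have tail: "((\<lambda>s. Mf * exp (- lam * s)) has_integral Mf * (exp (- lam * t) / lam)) {t..}"
    by (intro has_integral_mult_right has_integral_exp_minus_to_infinity pos)
  have "norm (integral {t..} (\<lambda>s. f (y s) (\<alpha> s) * exp (- lam * s))) \<le> integral {t..} (\<lambda>s. Mf * exp (- lam * s))"
    using assms(3) cost_bound[OF assms(1,2)] tail
    by (intro integral_norm_bound_integral cost_integrable[OF assms(1,2)])
      (auto simp: abs_mult intro!: mult_right_mono)
  then show ?thesis
    using integral_unique[OF tail] by simp
qed

lemma cost_split:
  assumes "\<alpha> \<in> controls a" "trajectory \<Omega> g x \<alpha> y"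
  defines "F \<equiv> \<lambda>s. f (y s) (\<alpha> s) * exp (- lam * s)"
  shows "integral {0..} F =
    (\<Sum>n<N. integral {real n * h..real (Suc n) * h} F) + integral {real N * h..} F"
proof (induction N)
  case 0
  then show ?case by simp
next
  case (Suc N)
  let ?s = "real N * h" and ?t = "real (Suc N) * h"
  have st: "0 \<le> ?s" "?s \<le> ?t"
    using pos by (auto simp: algebra_simps)
  have "F integrable_on {?s..?t}" "F integrable_on {?t..}"
    unfolding F_def using st by (intro cost_integrable[OF assms(1,2)]; auto)+
  then have "(F has_integral (integral {?s..?t} F + integral {?t..} F)) ({?s..?t} \<union> {?t..})"
    using st by (intro has_integral_Un integrable_integral) (auto intro: negligible_subset[of "{?t}"])
  moreover have "{?s..?t} \<union> {?t..} = {?s..}"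
    using st by auto
  ultimately have "integral {?s..} F = integral {?s..?t} F + integral {?t..} F"
    by (simp add: integral_unique)
  with Suc show ?case by simp
qed

text \<open>Growth of a state error per step after discounting. Since \<open>q \<le> E\<close>, it
  also dominates the factor \<open>q * \<rho>\<close> of the fully discrete comparison, so both
  errors are expressed by the same sum.\<close>

abbreviation "\<sigma> \<equiv> E * \<rho>"

text \<open>Control and sequence need only be close, so that one estimate serves both inequalities
  for the value function: with \<open>v = 0\<close> if \<open>\<alpha>\<close> is the step function
  of \<open>c\<close>, and with the oscillations of \<open>\<alpha>\<close> on the cells if
  \<open>c\<close> samples it.\<close>

lemma cost_euler_error:
  assumes \<alpha>: "\<alpha> \<in> controls a" and y: "trajectory \<Omega> g x \<alpha> y"
    and c: "\<And>n. c n \<in> {0..1}" and p: "\<And>n. euler g h c x n \<in> \<Omega>"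
    and v: "\<And>n. v n \<ge> 0" and v2: "\<And>m. (\<Sum>n<m. v n) \<le> 2"
    and near: "\<And>n s. real n * h \<le> s \<Longrightarrow> s < real (Suc n) * h \<Longrightarrow> \<bar>\<alpha> s - c n\<bar> \<le> h + v n"
  shows "\<bar>integral {0..} (\<lambda>s. f (y s) (\<alpha> s) * exp (- lam * s)) - euler_cost lam g f h c x N\<bar> \<le>
    Lf * (Mg + 1 + 2 * Lg) * h * (\<Sum>n<N. h * \<sigma> ^ n) +
    (Lf * (Mg + 1) * (1 / lam + h) + 2 * Lf + 2 * Mf) * h + Mf / lam * E ^ N"
proof -
  define F where "F = (\<lambda>s. f (y s) (\<alpha> s) * exp (- lam * s))"
  define \<phi> where "\<phi> n = f (euler g h c x n) (c n)" for n
  define I where "I n = integral {real n * h..real (Suc n) * h} F" for n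
  define C where "C = Mg + 1 + 2 * Lg"
  \<comment> \<open>The four terms: accumulated distance from the Euler path, motion and rounding
    within the cell, variation of the control, decay of the discount over the cell.\<close>
  define B where "B n = Lf * C * h * \<sigma> ^ n + Lf * (Mg + 1) * h * E ^ n + Lf * v n + Mf * (E ^ n - E ^ Suc n)" for n
  have C: "C \<ge> 0"
    unfolding C_def using pos by simp
  have \<phi>: "\<bar>\<phi> n\<bar> \<le> Mf" for n
    unfolding \<phi>_def using lipschitz_bounded_normD[OF lip_f p c] by simp
  have E_le: "E ^ n \<le> 1" for n
    using E_bounds by (intro power_le_one) auto
  have cell: "\<bar>I n - h * E ^ n * \<phi> n\<bar> \<le> h * B n" for n
  proof -
    let ?s = "real n * h" and ?t = "real (Suc n) * h"
    have st: "0 \<le> ?s" "?s \<le> ?t" "?t - ?s = h"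
      using pos by (auto simp: algebra_simps)
    have "\<rho> ^ n \<ge> 1"
      using pos by (intro one_le_power) simp
    moreover have "\<rho> ^ n * (h * Lg * (\<Sum>i<n. v i)) \<le> \<rho> ^ n * (h * Lg * 2)"
      using pos by (intro mult_left_mono v2) auto
    moreover have "(\<rho> ^ n - 1) * ((Mg + 1) * h) \<le> \<rho> ^ n * ((Mg + 1) * h)"
      using pos by (intro mult_right_mono) auto
    ultimately have "norm (y ?s - euler g h c x n) \<le> \<rho> ^ n * (h * Lg * 2) + \<rho> ^ n * ((Mg + 1) * h)"
      using trajectory_euler_error[OF \<alpha> y c p v near, of n] by linarith
    then have D: "norm (y ?s - euler g h c x n) \<le> C * h * \<rho> ^ n"
      by (simp add: C_def algebra_simps)
    have "norm (F r - E ^ n * \<phi> n) \<le> B n" if r: "?s \<le> r" "r < ?t" for r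
    proof -
      have r0: "r \<ge> 0"
        using r st(1) by linarith
      have "norm (y r - y ?s) \<le> (r - ?s) * Mg"
        using trajectory_speed[OF \<alpha> y st(1) r(1)] .
      also have "\<dots> \<le> h * Mg"
        using pos r st by (intro mult_right_mono) auto
      finally have "norm (y r - euler g h c x n) \<le> h * Mg + C * h * \<rho> ^ n"
        using D norm_triangle_ineq[of "y r - y ?s" "y ?s - euler g h c x n"] by simp
      then have "norm (y r - euler g h c x n) + \<bar>\<alpha> r - c n\<bar> \<le> C * h * \<rho> ^ n + (Mg + 1) * h + v n"
        using near[OF r] by (simp add: algebra_simps)
      then have "Lf * (norm (y r - euler g h c x n) + \<bar>\<alpha> r - c n\<bar>) \<le> Lf * (C * h * \<rho> ^ n + (Mg + 1) * h + v n)"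
        using pos by (intro mult_left_mono) auto
      moreover have "\<bar>f (y r) (\<alpha> r) - \<phi> n\<bar> \<le> Lf * (norm (y r - euler g h c x n) + \<bar>\<alpha> r - c n\<bar>)"
        unfolding \<phi>_def using y r0 lipschitz_boundedD[OF lip_f _ p[of n] controls_unit[OF \<alpha> r0] c[of n], of "y r"]
        by (simp add: trajectory_def)
      ultimately have "\<bar>f (y r) (\<alpha> r) - \<phi> n\<bar> \<le> Lf * (C * h * \<rho> ^ n + (Mg + 1) * h + v n)"
        by linarith
      then have "E ^ n * \<bar>f (y r) (\<alpha> r) - \<phi> n\<bar> \<le> E ^ n * (Lf * (C * h * \<rho> ^ n + (Mg + 1) * h + v n))"
        using E_bounds by (intro mult_left_mono) auto
      also have "\<dots> = Lf * C * h * \<sigma> ^ n + Lf * (Mg + 1) * h * E ^ n + Lf * (E ^ n * v n)"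
        unfolding power_mult_distrib by (simp add: algebra_simps)
      \<comment> \<open>The discount in front of \<open>v n\<close> is dropped, because the sum of
        the \<open>v n\<close> is bounded without it.\<close>
      also have "\<dots> \<le> Lf * C * h * \<sigma> ^ n + Lf * (Mg + 1) * h * E ^ n + Lf * (1 * v n)"
        using pos v[of n] E_le[of n] by (intro add_left_mono mult_left_mono mult_right_mono) auto
      finally have 1: "E ^ n * \<bar>f (y r) (\<alpha> r) - \<phi> n\<bar> \<le>
          Lf * C * h * \<sigma> ^ n + Lf * (Mg + 1) * h * E ^ n + Lf * v n" by simp
      have e: "exp (- lam * r) \<le> E ^ n" "E ^ Suc n \<le> exp (- lam * r)"
        unfolding exp_power using r pos by (auto intro!: mult_left_mono)
      have "\<bar>f (y r) (\<alpha> r)\<bar> * (E ^ n - exp (- lam * r)) \<le> Mf * (E ^ n - exp (- lam * r))"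
        using e cost_bound[OF \<alpha> y r0] by (intro mult_right_mono) auto
      also have "\<dots> \<le> Mf * (E ^ n - E ^ Suc n)"
        using e pos by (intro mult_left_mono diff_left_mono) auto
      finally have 2: "\<bar>f (y r) (\<alpha> r)\<bar> * (E ^ n - exp (- lam * r)) \<le> Mf * (E ^ n - E ^ Suc n)" .
      have "F r - E ^ n * \<phi> n = E ^ n * (f (y r) (\<alpha> r) - \<phi> n) + - (f (y r) (\<alpha> r) * (E ^ n - exp (- lam * r)))"
        by (simp add: F_def algebra_simps)
      also have "\<bar>\<dots>\<bar> \<le> \<bar>E ^ n * (f (y r) (\<alpha> r) - \<phi> n)\<bar> + \<bar>f (y r) (\<alpha> r) * (E ^ n - exp (- lam * r))\<bar>"
        using abs_triangle_ineq[of "E ^ n * (f (y r) (\<alpha> r) - \<phi> n)" "- (f (y r) (\<alpha> r) * (E ^ n - exp (- lam * r)))"]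
        by (simp only: abs_minus_cancel)
      also have "\<dots> = E ^ n * \<bar>f (y r) (\<alpha> r) - \<phi> n\<bar> + \<bar>f (y r) (\<alpha> r)\<bar> * (E ^ n - exp (- lam * r))"
        using E_bounds e(1) by (simp only: abs_mult abs_of_nonneg zero_le_power less_imp_le diff_ge_0_iff_ge)
      finally show ?thesis
        using 1 2 by (simp add: B_def)
    qed
    moreover have "(F has_integral I n) {?s..?t}"
      unfolding I_def F_def using st by (intro integrable_integral cost_integrable[OF \<alpha> y]) auto
    moreover have "B n \<ge> 0"
    proof -
      have "E ^ Suc n \<le> E ^ n"
        using E_bounds by (intro power_decreasing) auto
      then show ?thesis
        unfolding B_def C_def using pos v[of n] E_bounds
        by (intro add_nonneg_nonneg mult_nonneg_nonneg zero_le_power) auto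
    qed
    ultimately have "norm (I n - (?t - ?s) *\<^sub>R (E ^ n * \<phi> n)) \<le> (?t - ?s) * B n"
      using st by (intro has_integral_near_constant) auto
    then show ?thesis
      unfolding st(3) by (simp add: mult.assoc)
  qed
  \<comment> \<open>Only here does the discount \<open>q ^ n\<close> of the discrete operator
    replace the exponential one; the differences add up to order \<open>h\<close> by
    \<open>sum_E_minus_q_le\<close>.\<close>
  have cell': "\<bar>I n - h * q ^ n * \<phi> n\<bar> \<le> h * B n + Mf * (h * (E ^ n - q ^ n))" for n
  proof -
    have "q ^ n \<le> E ^ n"
      using q_bounds by (intro power_mono q_le_E) auto
    then have nonneg: "0 \<le> h * (E ^ n - q ^ n)"
      using pos by simp
    have "h * E ^ n * \<phi> n - h * q ^ n * \<phi> n = \<phi> n * (h * (E ^ n - q ^ n))"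
      by (simp add: algebra_simps)
    then have "\<bar>h * E ^ n * \<phi> n - h * q ^ n * \<phi> n\<bar> = \<bar>\<phi> n\<bar> * (h * (E ^ n - q ^ n))"
      by (simp only: abs_mult[of "\<phi> n"] abs_of_nonneg[OF nonneg])
    also have "\<dots> \<le> Mf * (h * (E ^ n - q ^ n))"
      by (intro mult_right_mono \<phi> nonneg)
    finally have "\<bar>h * E ^ n * \<phi> n - h * q ^ n * \<phi> n\<bar> \<le> Mf * (h * (E ^ n - q ^ n))" .
    with cell[of n] show ?thesis by linarith
  qed
  have "integral {0..} F - euler_cost lam g f h c x N =
      (\<Sum>n<N. I n - h * q ^ n * \<phi> n) + integral {real N * h..} F"
    using cost_split[OF \<alpha> y, of N]
    by (simp add: F_def I_def \<phi>_def euler_cost_def sum_subtractf)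
  also have "\<bar>\<dots>\<bar> \<le> \<bar>\<Sum>n<N. I n - h * q ^ n * \<phi> n\<bar> + \<bar>integral {real N * h..} F\<bar>"
    by (rule abs_triangle_ineq)
  also have "\<bar>\<Sum>n<N. I n - h * q ^ n * \<phi> n\<bar> \<le> (\<Sum>n<N. h * B n + Mf * (h * (E ^ n - q ^ n)))"
    by (rule order_trans[OF sum_abs]) (intro sum_mono cell')
  also have "\<dots> = Lf * C * h * (\<Sum>n<N. h * \<sigma> ^ n) + Lf * (Mg + 1) * h * (\<Sum>n<N. h * E ^ n)
      + Lf * h * (\<Sum>n<N. v n) + Mf * h * (\<Sum>n<N. E ^ n - E ^ Suc n) + Mf * (\<Sum>n<N. h * (E ^ n - q ^ n))"
    unfolding B_def distrib_left sum.distrib sum_distrib_left by (simp only: mult_ac)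
  \<comment> \<open>All sums are bounded independently of \<open>N\<close> except that of
    \<open>\<sigma> ^ n\<close>, which may grow and is left to the choice of the horizon.\<close>
  also have "\<dots> \<le> Lf * C * h * (\<Sum>n<N. h * \<sigma> ^ n) + Lf * (Mg + 1) * h * (1 / lam + h)
      + Lf * h * 2 + Mf * h * 1 + Mf * h"
  proof (intro add_mono mult_left_mono order_refl sum_E_le v2 sum_E_minus_q_le)
    show "(\<Sum>n<N. E ^ n - E ^ Suc n) \<le> 1"
      unfolding sum_lessThan_telescope' using E_bounds by simp
  qed (use pos C in auto)
  also have "\<bar>integral {real N * h..} F\<bar> \<le> Mf / lam * E ^ N"
    unfolding F_def exp_power using pos by (intro cost_tail[OF \<alpha> y]) simp
  finally show ?thesis
    by (simp add: F_def C_def algebra_simps)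
qed

end

text \<open>Sampling at the grid times and rounding down preserves monotonicity and costs
  \<open>h\<close> plus the increment of \<open>\<alpha>\<close> over the cell; these increments
  telescope to at most 1. The first cell is special: \<open>c 0 = a\<close> is forced although
  \<open>\<alpha>\<close> may start anywhere above \<open>a\<close>, hence \<open>v 0 = 1\<close>
  and the total 2.\<close>

lemma grid_approximation:
  assumes h: "h > 0" and \<alpha>: "\<alpha> \<in> controls a" and a: "a \<in> control_grid h"
  obtains c v where "c \<in> grid_controls h a" "\<And>n. v n \<ge> 0" "\<And>m. (\<Sum>n<m. v n) \<le> 2"
    "\<And>n s. real n * h \<le> s \<Longrightarrow> s < real (Suc n) * h \<Longrightarrow> \<bar>\<alpha> s - c n\<bar> \<le> h + v n"
proof -
  have mono: "\<alpha> s \<le> \<alpha> t" if "0 \<le> s" "s \<le> t" for s t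
    using \<alpha> that by (auto simp: controls_def mono_on_def)
  have unit: "0 \<le> \<alpha> s" "\<alpha> s \<le> 1" if "0 \<le> s" for s
    using controls_unit[OF \<alpha> that] by auto
  have a0: "a \<le> \<alpha> 0"
    using \<alpha> by (simp add: controls_def)
  have a1: "0 \<le> a" "a \<le> 1"
    using control_grid_subset[OF h] a by auto
  have nh: "real n * h \<ge> 0" "real n * h \<le> real m * h" if "n \<le> m" for n m
    using h that by (auto intro: mult_right_mono)
  define j where "j n = nat \<lfloor>\<alpha> (real n * h) / h\<rfloor>" for n
  define c where "c n = (if n = 0 then a else real (j n) * h)" for n
  define v where "v n = (if n = 0 then 1 else \<alpha> (real (Suc n) * h) - \<alpha> (real n * h))" for n
  have j_le: "real (j n) * h \<le> \<alpha> (real n * h)" for n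
  proof -
    have "real (j n) \<le> \<alpha> (real n * h) / h"
      unfolding j_def using unit(1)[of "real n * h"] h by (intro of_nat_floor) simp
    then show ?thesis
      using h by (simp add: pos_le_divide_eq)
  qed
  have j_gt: "\<alpha> (real n * h) \<le> real (j n) * h + h" for n
  proof -
    have "\<alpha> (real n * h) / h \<le> real (j n) + 1"
      unfolding j_def by linarith
    then show ?thesis
      using h by (simp add: field_simps)
  qed
  have grid: "c n \<in> control_grid h" for n
  proof -
    have "real (j n) \<le> 1 / h"
      using order_trans[OF j_le[of n] unit(2)[OF nh(1)[OF order_refl]]] h by (simp add: field_simps)
    then show ?thesis
      using a by (auto simp: c_def control_grid_def)
  qed
  obtain i where i: "a = real i * h"
    using a by (auto simp: control_grid_def)
  have "c n \<le> c (Suc n)" for n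
  proof (cases "n = 0")
    case True
    have "real i * h \<le> \<alpha> (real (Suc 0) * h)"
      using a0 mono[of 0 "real (Suc 0) * h"] h i by simp
    \<comment> \<open>Rounding down cannot pass below \<open>a\<close>, which is itself a multiple
      of \<open>h\<close>.\<close>
    then have "i \<le> j (Suc 0)"
      unfolding j_def using h by (intro le_nat_floor) (simp add: field_simps)
    then show ?thesis
      using True h i by (simp add: c_def)
  next
    case False
    have "j n \<le> j (Suc n)"
      unfolding j_def using mono[OF nh[of n "Suc n"]] h
      by (intro nat_mono floor_mono divide_right_mono) auto
    then show ?thesis
      using False h by (simp add: c_def)
  qed
  then have "c \<in> grid_controls h a"
    using grid c_def[of 0] unfolding grid_controls_def mono_iff_le_Suc by auto
  moreover have "v n \<ge> 0" for n
    using mono[OF nh[of n "Suc n"]] by (simp add: v_def)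
  moreover have "(\<Sum>n<m. v n) \<le> 2" for m
  proof (cases m)
    case (Suc l)
    have "(\<Sum>n<Suc l. v n) = 1 + \<alpha> (real (Suc l) * h) - \<alpha> h"
      by (induction l) (auto simp: v_def)
    then show ?thesis
      using Suc unit(2)[OF nh(1)[OF order_refl, of m]] unit(1)[of h] h by simp
  qed simp
  moreover have "\<bar>\<alpha> s - c n\<bar> \<le> h + v n" if s: "real n * h \<le> s" "s < real (Suc n) * h" for n s
  proof -
    have s0: "0 \<le> s"
      using s(1) nh(1)[of n n] by linarith
    show ?thesis
    proof (cases "n = 0")
      case True
      then show ?thesis
        using unit[OF s0] a1 h by (simp add: c_def v_def abs_le_iff)
    next
      case False
      then show ?thesis
        using mono[OF nh(1)[OF order_refl] s(1)] mono[OF s0 less_imp_le[OF s(2)]] j_le[of n] j_gt[of n] h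
        by (simp add: c_def v_def abs_le_iff)
    qed
  qed
  ultimately show thesis
    by (rule that)
qed

text \<open>The step function of a grid control is itself admissible, so an optimal discrete
  sequence gives a competitor for the value function without any error in the control.\<close>

lemma step_control:
  assumes h: "h > 0" and c: "c \<in> grid_controls h a"
  defines "\<alpha> \<equiv> \<lambda>s. c (nat \<lfloor>s / h\<rfloor>)"
  shows "\<alpha> \<in> controls a"
    and "\<And>n s. real n * h \<le> s \<Longrightarrow> s < real (Suc n) * h \<Longrightarrow> \<alpha> s = c n"
proof -
  have "c n \<in> {0..1}" for n
    using c control_grid_subset[OF h] unfolding grid_controls_def by blast
  moreover have "mono_on {0..} \<alpha>"
    unfolding \<alpha>_def using h c
    by (auto simp: mono_on_def grid_controls_def intro!: monoD[of c] nat_mono floor_mono divide_right_mono)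
  ultimately show "\<alpha> \<in> controls a"
    using c by (auto simp: controls_def \<alpha>_def grid_controls_def)
  show "\<alpha> s = c n" if "real n * h \<le> s" "s < real (Suc n) * h" for n s
  proof -
    have "\<lfloor>s / h\<rfloor> = int n"
      using that h by (intro floor_unique) (auto simp: field_simps)
    then show ?thesis
      by (simp add: \<alpha>_def)
  qed
qed

section \<open>The value function against the time-discrete value\<close>

context control_problem
begin

text \<open>An optimal grid control, read as a step control, bounds the infimum from above; sampling
  an arbitrary control bounds it from below. The set \<open>X\<close> is to be the triangulated
  domain: its invariance keeps Euler paths in \<open>\<Omega>\<close>, where the Lipschitz bounds
  hold.\<close>

lemma value_horizon_error:
  assumes viab: "viable \<Omega> g" and X: "X \<subseteq> \<Omega>"
    and inv: "\<And>x a. x \<in> X \<Longrightarrow> a \<in> control_grid h \<Longrightarrow> x + h *\<^sub>R g x a \<in> X"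
    and x: "x \<in> X" and a: "a \<in> control_grid h"
  shows "\<bar>value_function \<Omega> lam g f x a - horizon_value lam g f h N x a\<bar> \<le>
    Lf * (Mg + 1 + 2 * Lg) * h * (\<Sum>n<N. h * \<sigma> ^ n) +
    (Lf * (Mg + 1) * (1 / lam + h) + 2 * Lf + 2 * Mf) * h + Mf / lam * E ^ N" (is "_ \<le> ?B")
proof -
  define J where "J \<alpha> y = integral {0..} (\<lambda>s. f (y s) (\<alpha> s) * exp (- lam * s))" for \<alpha> y
  define Z where "Z = {J \<alpha> y | \<alpha> y. \<alpha> \<in> controls a \<and> trajectory \<Omega> g x \<alpha> y}"
  have u: "value_function \<Omega> lam g f x a = Inf Z"
    by (simp add: value_function_def Z_def J_def)
  have exist: "\<exists>y. trajectory \<Omega> g x \<alpha> y" if "\<alpha> \<in> controls a" for \<alpha>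
    using viab X x grid_unit[OF a] that unfolding viable_def by blast
  have c_unit: "c n \<in> {0..1}" if "c \<in> grid_controls h a" for c n
    using that by (intro grid_unit) (auto simp: grid_controls_def)
  have path: "euler g h c x n \<in> \<Omega>" if "c \<in> grid_controls h a" for c n
  proof -
    have "euler g h c x n \<in> X"
      using that by (induction n) (auto simp: x grid_controls_def intro!: inv)
    then show ?thesis using X by blast
  qed
  have "Inf Z \<le> horizon_value lam g f h N x a + ?B"
  proof -
    obtain c where c: "c \<in> grid_controls h a" "horizon_value lam g f h N x a = euler_cost lam g f h c x N"
      using horizon_value_attained[OF pos(6) a] by blast
    note step = step_control[OF pos(6) c(1)]
    obtain y where y: "trajectory \<Omega> g x (\<lambda>s. c (nat \<lfloor>s / h\<rfloor>)) y"
      using exist[OF step(1)] by blast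
    have "bdd_below Z"
    proof (rule bdd_belowI)
      fix z assume "z \<in> Z"
      then obtain \<alpha> y where "z = J \<alpha> y" "\<alpha> \<in> controls a" "trajectory \<Omega> g x \<alpha> y"
        by (auto simp: Z_def)
      then show "- (Mf / lam) \<le> z"
        using cost_tail[of \<alpha> a x y 0] by (simp add: J_def abs_le_iff)
    qed
    then have "Inf Z \<le> J (\<lambda>s. c (nat \<lfloor>s / h\<rfloor>)) y"
      using step(1) y by (intro cInf_lower) (auto simp: Z_def)
    moreover have "\<bar>J (\<lambda>s. c (nat \<lfloor>s / h\<rfloor>)) y - euler_cost lam g f h c x N\<bar> \<le> ?B"
      unfolding J_def using pos step(2)
      by (intro cost_euler_error[OF step(1) y c_unit[OF c(1)] path[OF c(1)], of "\<lambda>_. 0"]) auto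
    ultimately show ?thesis
      unfolding c(2) by linarith
  qed
  moreover have "horizon_value lam g f h N x a - ?B \<le> Inf Z"
  proof (rule cInf_greatest)
    have "(\<lambda>_. 1) \<in> controls a"
      using grid_unit[OF a] by (auto simp: controls_def mono_on_def)
    then show "Z \<noteq> {}"
      using exist unfolding Z_def by blast
    fix z assume "z \<in> Z"
    then obtain \<alpha> y where z: "z = J \<alpha> y" and \<alpha>: "\<alpha> \<in> controls a" and y: "trajectory \<Omega> g x \<alpha> y"
      by (auto simp: Z_def)
    obtain c v where c: "c \<in> grid_controls h a" and v: "\<And>n. v n \<ge> 0" "\<And>m. (\<Sum>n<m. v n) \<le> 2"
      "\<And>n s. real n * h \<le> s \<Longrightarrow> s < real (Suc n) * h \<Longrightarrow> \<bar>\<alpha> s - c n\<bar> \<le> h + v n"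
      using grid_approximation[OF pos(6) \<alpha> a] by metis
    have "\<bar>J \<alpha> y - euler_cost lam g f h c x N\<bar> \<le> ?B"
      unfolding J_def by (rule cost_euler_error[OF \<alpha> y c_unit[OF c] path[OF c] v])
    then show "horizon_value lam g f h N x a - ?B \<le> z"
      using horizon_value_le[OF pos(6) lam_h c, where n = N and x = x and g = g and f = f] unfolding z by linarith
  qed
  ultimately show ?thesis
    unfolding u by linarith
qed

end

section \<open>The total error in terms of the time step\<close>

context discretization
begin

lemma total_error:
  assumes viab: "viable \<Omega> g" and h1: "h \<le> 1" and c1: "c1 > 0" "c1 * k powr (2/3) \<le> h"
    and x: "x \<in> \<Union>\<T>" and a: "a \<in> control_grid h"
  shows "\<bar>value_function \<Omega> lam g f x a - w x a\<bar> \<le>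
    (Lf * (sqrt ((1 + 1 / (2 * Lg)) / c1 ^ 3) + (Mg + 1 + 2 * Lg) + (Mg + 1) * (1 / lam + 1) + 2) + 2 * Mf + 2 * Mf / lam) *
    (h * (\<Sum>n<N. h * \<sigma> ^ n) + h + E ^ N)"
proof -
  define S where "S = (\<Sum>n<N. h * \<sigma> ^ n)"
  have S: "S \<ge> 0"
    unfolding S_def using pos by (intro sum_nonneg) auto
  have "sqrt (k\<^sup>2 + \<eta>) \<le> sqrt ((1 + 1 / (2 * Lg)) / c1 ^ 3 * h\<^sup>2)"
  proof (rule real_sqrt_le_mono)
    \<comment> \<open>The lower bound on \<open>h\<close> gives
      \<open>k\<^sup>2 \<le> h ^ 3 / c1 ^ 3\<close>, so \<open>\<eta>\<close>, of order
      \<open>k\<^sup>2 / h\<close>, is of order \<open>h\<^sup>2\<close>, and the interpolation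
      error has the same order \<open>h\<close> as the time error.\<close>
    have "k powr (2/3) \<le> h / c1"
      using c1 by (simp add: field_simps)
    then have "(k powr (2/3)) ^ 3 \<le> (h / c1) ^ 3"
      by (intro power_mono) auto
    also have "(k powr (2/3)) ^ 3 = k\<^sup>2"
      using k_pos by (simp add: powr_power)
    finally have k: "k\<^sup>2 \<le> h ^ 3 / c1 ^ 3"
      by (simp add: power_divide)
    have "h ^ 3 \<le> h\<^sup>2"
      using pos h1 by (intro power_decreasing) auto
    then have "h ^ 3 / c1 ^ 3 \<le> h\<^sup>2 / c1 ^ 3"
      using c1 by (intro divide_right_mono) auto
    moreover have "\<eta> \<le> (h ^ 3 / c1 ^ 3) / (2 * h * Lg)"
      unfolding \<eta>_def using pos by (intro divide_right_mono k) auto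
    moreover have "(h ^ 3 / c1 ^ 3) / (2 * h * Lg) = h\<^sup>2 / c1 ^ 3 * (1 / (2 * Lg))"
      using pos by (simp add: power2_eq_square power3_eq_cube)
    moreover have "(1 + 1 / (2 * Lg)) / c1 ^ 3 * h\<^sup>2 = h\<^sup>2 / c1 ^ 3 + h\<^sup>2 / c1 ^ 3 * (1 / (2 * Lg))"
      by (simp add: add_divide_distrib distrib_right)
    ultimately show "k\<^sup>2 + \<eta> \<le> (1 + 1 / (2 * Lg)) / c1 ^ 3 * h\<^sup>2"
      using k by linarith
  qed
  also have "\<dots> = sqrt ((1 + 1 / (2 * Lg)) / c1 ^ 3) * h"
    unfolding real_sqrt_mult using pos by simp
  finally have root: "sqrt (k\<^sup>2 + \<eta>) \<le> sqrt ((1 + 1 / (2 * Lg)) / c1 ^ 3) * h" .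
  define A where "A = sqrt ((1 + 1 / (2 * Lg)) / c1 ^ 3)"
  \<comment> \<open>The sum of the three coefficients obtained below for \<open>h * S\<close>,
    \<open>h\<close> and \<open>E ^ N\<close>, hence an upper bound for each of them.\<close>
  define K where "K = Lf * (A + (Mg + 1 + 2 * Lg) + (Mg + 1) * (1 / lam + 1) + 2) + 2 * Mf + 2 * Mf / lam"
  have A: "A \<ge> 0"
    unfolding A_def using pos c1 by simp
  have "h * (\<Sum>i<N. (q * \<rho>) ^ i) \<le> S"
    unfolding S_def sum_distrib_left using pos q_bounds q_le_E
    by (intro sum_mono mult_left_mono power_mono mult_right_mono) auto
  then have "h * Lf * (\<Sum>i<N. (q * \<rho>) ^ i) * sqrt (k\<^sup>2 + \<eta>) \<le> Lf * S * (A * h)"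
    unfolding A_def mult.commute[of h Lf] mult.assoc[of Lf h] using root pos S \<eta>_pos
    by (intro mult_mono mult_left_mono) auto
  moreover have "q ^ N * (Mf / lam) \<le> E ^ N * (Mf / lam)"
    using pos q_bounds by (intro mult_right_mono power_mono q_le_E) auto
  moreover note horizon_error[OF x a, of N]
    value_horizon_error[OF viab sub inv x a, of N, folded S_def]
  moreover have "(Lf * (Mg + 1) * (1 / lam + h) + 2 * Lf + 2 * Mf) * h \<le>
      (Lf * (Mg + 1) * (1 / lam + 1) + 2 * Lf + 2 * Mf) * h"
    using pos h1 by (intro mult_right_mono add_right_mono mult_left_mono) auto
  moreover have "Lf * (A + (Mg + 1 + 2 * Lg)) * (h * S) = Lf * S * (A * h) + Lf * (Mg + 1 + 2 * Lg) * h * S"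
    by (simp add: algebra_simps)
  moreover have "2 * Mf / lam * E ^ N = Mf / lam * E ^ N + E ^ N * (Mf / lam)"
    by simp
  ultimately have "\<bar>value_function \<Omega> lam g f x a - w x a\<bar> \<le>
      Lf * (A + (Mg + 1 + 2 * Lg)) * (h * S) + (Lf * (Mg + 1) * (1 / lam + 1) + 2 * Lf + 2 * Mf) * h + 2 * Mf / lam * E ^ N"
    by linarith
  also have "\<dots> \<le> K * (h * S) + K * h + K * E ^ N"
  proof (intro add_mono mult_right_mono)
    have "Lf * (A + (Mg + 1 + 2 * Lg)) \<ge> 0" "Lf * (Mg + 1) * (1 / lam + 1) \<ge> 0" "2 * Mf / lam \<ge> 0"
      using pos A by (auto intro!: mult_nonneg_nonneg add_nonneg_nonneg)
    moreover have "K = Lf * (A + (Mg + 1 + 2 * Lg)) + Lf * (Mg + 1) * (1 / lam + 1) + 2 * Lf + 2 * Mf + 2 * Mf / lam"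
      by (simp add: K_def distrib_left)
    ultimately show "Lf * (A + (Mg + 1 + 2 * Lg)) \<le> K"
      "Lf * (Mg + 1) * (1 / lam + 1) + 2 * Lf + 2 * Mf \<le> K" "2 * Mf / lam \<le> K"
      using pos by linarith+
  qed (use pos S in auto)
  finally show ?thesis
    by (simp only: A_def K_def S_def distrib_left)
qed

end

section \<open>Choice of the horizon\<close>

text \<open>For a horizon \<open>T = N * h\<close> the tail is \<open>exp (- lam * T)\<close>, while
  the sum stays bounded if \<open>L < lam\<close> and is at most of order
  \<open>exp ((L - lam) * T)\<close> if \<open>L > lam\<close>. For \<open>L = lam\<close> it could
  be of order \<open>T\<close>, and balancing would leave a logarithm of \<open>h\<close>.\<close>

lemma horizon_choice:
  fixes lam L :: real
  assumes "lam > 0" "L > 0" "L \<noteq> lam"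
  defines "\<gamma> \<equiv> if L < lam then 1 else lam / L"
  shows "\<exists>K\<ge>0. \<forall>h. 0 < h \<and> h \<le> 1 \<longrightarrow>
    (\<exists>N. h * (\<Sum>n<N. h * (exp (- lam * h) * (1 + h * L)) ^ n) + h + exp (- lam * h) ^ N \<le> K * h powr \<gamma>)"
proof (cases "L < lam")
  case True
  define \<kappa> where "\<kappa> = lam - L"
  have \<kappa>: "\<kappa> > 0"
    using True by (simp add: \<kappa>_def)
  have "\<exists>N. h * (\<Sum>n<N. h * (exp (- lam * h) * (1 + h * L)) ^ n) + h + exp (- lam * h) ^ N \<le> (1 / \<kappa> + 3) * h powr \<gamma>"
    if h: "0 < h" "h \<le> 1" for h
  proof -
    define r where "r = exp (- \<kappa> * h)"
    have r: "0 < r" "r < 1"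
      using \<kappa> h by (auto simp: r_def)
    have "exp (- lam * h) < 1"
      using assms(1) h by simp
    \<comment> \<open>The sum is bounded uniformly in \<open>N\<close>, so any horizon with a tail
      below \<open>h\<close> will do.\<close>
    then obtain N where N: "exp (- lam * h) ^ N < h"
      using real_arch_pow_inv[OF h(1)] by blast
    have "exp (- lam * h) * (1 + h * L) \<le> exp (- lam * h) * exp (h * L)"
      by (intro mult_left_mono) auto
    also have "\<dots> = r"
      by (simp add: r_def \<kappa>_def algebra_simps flip: exp_add)
    finally have "(\<Sum>n<N. h * (exp (- lam * h) * (1 + h * L)) ^ n) \<le> (\<Sum>n<N. h * r ^ n)"
      using h assms(2) by (intro sum_mono mult_left_mono power_mono) auto
    also have "\<dots> = (1 - r ^ N) * (h / (1 - r))"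
      using r by (simp add: sum_distrib_left[symmetric] sum_gp_strict)
    also have "\<dots> \<le> 1 * (h / (1 - r))"
      using r h by (intro mult_right_mono) auto
    also have "\<dots> \<le> 1 / \<kappa> + 1"
      using step_over_decay[OF \<kappa> h(1)] h by (simp add: r_def)
    finally have "h * (\<Sum>n<N. h * (exp (- lam * h) * (1 + h * L)) ^ n) \<le> h * (1 / \<kappa> + 1)"
      using h by (intro mult_left_mono) auto
    then have "h * (\<Sum>n<N. h * (exp (- lam * h) * (1 + h * L)) ^ n) + h + exp (- lam * h) ^ N \<le> (1 / \<kappa> + 3) * h"
      using N by (simp add: algebra_simps)
    then show ?thesis
      using True h by (auto simp: \<gamma>_def)
  qed
  then show ?thesis
    using \<kappa> by (intro exI[of _ "1 / \<kappa> + 3"]) auto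
next
  case False
  define \<kappa> where "\<kappa> = L - lam"
  have \<kappa>: "\<kappa> > 0"
    using False assms(3) by (simp add: \<kappa>_def)
  have \<gamma>: "\<gamma> = lam / L" "\<gamma> \<le> 1"
    using False assms(2) by (auto simp: \<gamma>_def)
  have "\<exists>N. h * (\<Sum>n<N. h * (exp (- lam * h) * (1 + h * L)) ^ n) + h + exp (- lam * h) ^ N \<le> (exp \<kappa> / \<kappa> + 2) * h powr \<gamma>"
    if h: "0 < h" "h \<le> 1" for h
  proof -
    \<comment> \<open>Balances the two errors: \<open>h * exp (\<kappa> * T)\<close> and
      \<open>exp (- lam * T)\<close> both equal \<open>h powr (lam / L)\<close>. Rounding up to a
      multiple of \<open>h\<close> costs at most a factor \<open>exp \<kappa>\<close>, as
      \<open>h \<le> 1\<close>.\<close>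
    define T where "T = - ln h / L"
    have T: "T \<ge> 0"
      using h assms(2) by (simp add: T_def divide_le_0_iff)
    define N where "N = nat \<lceil>T / h\<rceil>"
    have "T / h \<le> real N" "real N \<le> T / h + 1"
      using T h unfolding N_def by (auto simp: of_nat_ceiling)
    then have N: "T \<le> real N * h" "real N * h \<le> T + h"
      using h by (auto simp: field_simps)
    define R where "R = exp (\<kappa> * h)"
    have R: "\<kappa> * h \<le> R - 1" "R - 1 > 0"
    proof -
      show "\<kappa> * h \<le> R - 1"
        unfolding R_def using exp_ge_add_one_self[of "\<kappa> * h"] by linarith
      show "R - 1 > 0"
        using \<kappa> h by (simp add: R_def)
    qed
    have "exp (- lam * h) * (1 + h * L) \<le> exp (- lam * h) * exp (h * L)"
      by (intro mult_left_mono) auto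
    also have "\<dots> = R"
      by (simp add: R_def \<kappa>_def algebra_simps flip: exp_add)
    finally have "(\<Sum>n<N. h * (exp (- lam * h) * (1 + h * L)) ^ n) \<le> (\<Sum>n<N. h * R ^ n)"
      using h assms(2) by (intro sum_mono mult_left_mono power_mono) auto
    also have "\<dots> = h * ((R ^ N - 1) / (R - 1))"
      using R by (simp add: sum_distrib_left[symmetric] geometric_sum)
    also have "\<dots> \<le> h * (R ^ N / (\<kappa> * h))"
      using R \<kappa> h by (intro mult_left_mono frac_le) auto
    also have "\<dots> = R ^ N / \<kappa>"
      using h by simp
    also have "R ^ N = exp (\<kappa> * (real N * h))"
      by (simp add: R_def mult_ac flip: exp_of_nat_mult)
    also have "\<dots> \<le> exp (\<kappa> * (T + 1))"
      using N(2) h \<kappa> by auto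
    also have "\<dots> = exp \<kappa> * exp (\<kappa> * T)"
      by (simp add: algebra_simps flip: exp_add)
    also have "exp (\<kappa> * T) = h powr (\<gamma> - 1)"
      using h assms(2) by (simp add: powr_def T_def \<kappa>_def \<gamma>(1) field_simps)
    finally have "h * (\<Sum>n<N. h * (exp (- lam * h) * (1 + h * L)) ^ n) \<le> h * (exp \<kappa> * h powr (\<gamma> - 1) / \<kappa>)"
      using h \<kappa> by (intro mult_left_mono) (auto simp: divide_right_mono)
    also have "\<dots> = exp \<kappa> / \<kappa> * h powr \<gamma>"
      using h powr_add[of h 1 "\<gamma> - 1"] by simp
    finally have 1: "h * (\<Sum>n<N. h * (exp (- lam * h) * (1 + h * L)) ^ n) \<le> exp \<kappa> / \<kappa> * h powr \<gamma>" .
    have "exp (- lam * h) ^ N = exp (- lam * (real N * h))"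
      by (simp add: mult_ac flip: exp_of_nat_mult)
    also have "\<dots> \<le> exp (- lam * T)"
      using N(1) assms(1) by auto
    also have "\<dots> = h powr \<gamma>"
      using h by (simp add: powr_def T_def \<gamma>(1))
    finally have 2: "exp (- lam * h) ^ N \<le> h powr \<gamma>" .
    have "h powr 1 \<le> h powr \<gamma>"
      using \<gamma>(2) h by (intro powr_mono') auto
    with 1 2 h show ?thesis
      by (intro exI[of _ N]) (simp add: algebra_simps)
  qed
  then show ?thesis
    using \<kappa> by (intro exI[of _ "exp \<kappa> / \<kappa> + 2"]) auto
qed

text \<open>The constants of \<open>horizon_choice\<close> and \<open>total_error\<close> depend on
  the numerical data only, so \<open>C\<close> can be fixed before the domain, the dynamics and the
  meshes.\<close>

lemma convergence_rate:
  fixes lam Lg Mg Lf Mf h0 \<chi>1 \<chi>2 c1 c2 :: real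
  assumes pos: "lam > 0" "Lg > 0" "Mg > 0" "Lf > 0" "Mf > 0" "c1 > 0" and ne: "Lg \<noteq> lam"
  defines "\<gamma> \<equiv> if Lg < lam then 1 else lam / Lg"
  shows "\<exists>C. \<forall>(\<Omega> :: 'a::euclidean_space set) g f \<K> \<T>.
    open \<Omega> \<and> lipschitz_bounded \<Omega> Lg Mg g \<and> lipschitz_bounded \<Omega> Lf Mf f \<and> viable \<Omega> g \<and>
    triangulation_family \<Omega> g h0 \<chi>1 \<chi>2 \<K> \<T> \<longrightarrow>
    (\<forall>k\<in>\<K>. \<forall>h u_kh.
       0 < h \<and> h < min h0 (1 / lam) \<and> 1 / h \<in> \<nat> \<and>
       c1 * k powr (2/3) \<le> h \<and> h \<le> c2 * k powr (2/3) \<and>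
       discrete_solution lam g f (\<T> k) h u_kh \<longrightarrow>
       (\<forall>x\<in>\<Union>(\<T> k). \<forall>a\<in>control_grid h.
          \<bar>value_function \<Omega> lam g f x a - u_kh x a\<bar> \<le> C * k powr (2/3 * \<gamma>)))"
proof -
  obtain K where K: "K \<ge> 0" "\<And>h. 0 < h \<Longrightarrow> h \<le> 1 \<Longrightarrow>
    \<exists>N. h * (\<Sum>n<N. h * (exp (- lam * h) * (1 + h * Lg)) ^ n) + h + exp (- lam * h) ^ N \<le> K * h powr \<gamma>"
    using horizon_choice[OF pos(1,2) ne] unfolding \<gamma>_def by blast
  define A where "A = Lf * (sqrt ((1 + 1 / (2 * Lg)) / c1 ^ 3) + (Mg + 1 + 2 * Lg) + (Mg + 1) * (1 / lam + 1) + 2)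
    + 2 * Mf + 2 * Mf / lam"
  have A: "A \<ge> 0"
    unfolding A_def using pos by (intro add_nonneg_nonneg mult_nonneg_nonneg) auto
  have \<gamma>: "\<gamma> \<ge> 0"
    using pos by (simp add: \<gamma>_def)
  show ?thesis
  \<comment> \<open>\<open>A\<close> is the factor in \<open>total_error\<close>, \<open>K\<close>
    comes from the choice of the horizon, and \<open>c2 powr \<gamma>\<close> from turning
    \<open>h powr \<gamma>\<close> into a power of \<open>k\<close>.\<close>
  proof (intro exI[of _ "A * K * c2 powr \<gamma>"] allI impI ballI, elim conjE)
    fix \<Omega> :: "'a set" and g f \<K> \<T> k h w x a
    assume lip: "lipschitz_bounded \<Omega> Lg Mg g" "lipschitz_bounded \<Omega> Lf Mf f" and viab: "viable \<Omega> g"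
      and fam: "triangulation_family \<Omega> g h0 \<chi>1 \<chi>2 \<K> \<T>" and k: "k \<in> \<K>"
      and h: "0 < h" "h < min h0 (1 / lam)" "1 / h \<in> \<nat>"
      and ck: "c1 * k powr (2/3) \<le> h" "h \<le> c2 * k powr (2/3)"
      and sol: "discrete_solution lam g f (\<T> k) h w"
      and x: "x \<in> \<Union>(\<T> k)" and a: "a \<in> control_grid h"
    have k0: "k > 0"
      using fam k unfolding triangulation_family_def by auto
    have h1: "h \<le> 1"
    proof -
      obtain n where n: "1 / h = real n"
        using h(3) by (auto elim: Nats_cases)
      then have "n \<noteq> 0"
        using h(1) by (intro notI) simp
      then have "1 \<le> 1 / h"
        unfolding n by simp
      then show ?thesis
        using h(1) by (simp add: field_simps)
    qed
    have "c2 * k powr (2/3) > 0"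
      using h(1) ck(2) by linarith
    then have c2: "c2 > 0"
      using k0 by (simp add: zero_less_mult_iff)
    interpret discretization \<Omega> g f lam Lg Mg Lf Mf h "\<T> k" k w
    proof unfold_locales
      show "lam * h < 1"
        using h pos by (simp add: field_simps)
      show "triangulation (\<T> k)" "Max (diameter ` \<T> k) = k" "\<Union>(\<T> k) \<subseteq> \<Omega>"
        using fam k unfolding triangulation_family_def by simp_all
      fix x a assume xa: "x \<in> \<Union>(\<T> k)" "a \<in> control_grid h"
      have "\<forall>k\<in>\<K>. \<forall>h. 0 < h \<and> h < h0 \<and> 1 / h \<in> \<nat> \<longrightarrow>
        (\<forall>x\<in>\<Union>(\<T> k). \<forall>a\<in>control_grid h. x + h *\<^sub>R g x a \<in> \<Union>(\<T> k))"
        using fam unfolding triangulation_family_def by (elim conjE)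
      from bspec[OF this k] h
      have "\<forall>x\<in>\<Union>(\<T> k). \<forall>a\<in>control_grid h. x + h *\<^sub>R g x a \<in> \<Union>(\<T> k)"
        by simp
      with xa show "x + h *\<^sub>R g x a \<in> \<Union>(\<T> k)"
        by blast
    qed (fact pos lip h k0 sol)+
    obtain N where N: "h * (\<Sum>n<N. h * \<sigma> ^ n) + h + E ^ N \<le> K * h powr \<gamma>"
      using K(2)[OF h(1) h1] by blast
    have "\<bar>value_function \<Omega> lam g f x a - w x a\<bar> \<le> A * (h * (\<Sum>n<N. h * \<sigma> ^ n) + h + E ^ N)"
      unfolding A_def by (rule total_error[OF viab h1 assms(6) ck(1) x a])
    also have "\<dots> \<le> A * (K * h powr \<gamma>)"
      using A N by (intro mult_left_mono)
    also have "\<dots> \<le> A * (K * (c2 * k powr (2/3)) powr \<gamma>)"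
      using A K(1) h(1) ck(2) \<gamma> by (intro mult_left_mono powr_mono2) auto
    also have "(c2 * k powr (2/3)) powr \<gamma> = c2 powr \<gamma> * k powr (2/3 * \<gamma>)"
      using c2 by (simp add: powr_mult powr_powr)
    finally show "\<bar>value_function \<Omega> lam g f x a - w x a\<bar> \<le> A * K * c2 powr \<gamma> * k powr (2/3 * \<gamma>)"
      by (simp add: mult.assoc)
  qed
qed

theorem mainTheorem2:
  fixes lam Lg Mg Lf Mf h0 \<chi>1 \<chi>2 c1 c2 \<gamma> :: real
  assumes "lam > 0" and "Lg > 0" and "Mg > 0" and "Lf > 0" and "Mf > 0"
    and "h0 > 0" and "\<chi>1 > 0" and "c1 > 0" and "c2 > 0"
    and "Lg < lam \<Longrightarrow> \<gamma> = 1"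
    and "Lg > lam \<Longrightarrow> \<gamma> = lam / Lg"
    and "Lg = lam \<Longrightarrow> 0 < \<gamma> \<and> \<gamma> < 1"
  shows "\<exists>C. \<forall>(\<Omega> :: 'a::euclidean_space set) g f \<K> \<T>.
    open \<Omega> \<and> lipschitz_bounded \<Omega> Lg Mg g \<and> lipschitz_bounded \<Omega> Lf Mf f \<and> viable \<Omega> g \<and>
    triangulation_family \<Omega> g h0 \<chi>1 \<chi>2 \<K> \<T> \<longrightarrow>
    (\<forall>k\<in>\<K>. \<forall>h u_kh.
       0 < h \<and> h < min h0 (1 / lam) \<and> 1 / h \<in> \<nat> \<and>
       c1 * k powr (2/3) \<le> h \<and> h \<le> c2 * k powr (2/3) \<and>
       discrete_solution lam g f (\<T> k) h u_kh \<longrightarrow>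
       (\<forall>x\<in>\<Union>(\<T> k). \<forall>a\<in>control_grid h.
          \<bar>value_function \<Omega> lam g f x a - u_kh x a\<bar> \<le> C * k powr (2/3 * \<gamma>)))"
proof -
  \<comment> \<open>If \<open>Lg = lam\<close>, the larger Lipschitz constant \<open>lam / \<gamma>\<close> leads to the supercritical case.\<close>
  define L where "L = (if Lg = lam then lam / \<gamma> else Lg)"
  have L: "Lg \<le> L" "L > 0" "L \<noteq> lam" "\<gamma> = (if L < lam then 1 else lam / L)"
    using assms(1,2,10-12) by (auto simp: L_def field_simps)
  obtain C where C: "\<forall>(\<Omega> :: 'a set) g f \<K> \<T>.
    open \<Omega> \<and> lipschitz_bounded \<Omega> L Mg g \<and> lipschitz_bounded \<Omega> Lf Mf f \<and> viable \<Omega> g \<and>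
    triangulation_family \<Omega> g h0 \<chi>1 \<chi>2 \<K> \<T> \<longrightarrow>
    (\<forall>k\<in>\<K>. \<forall>h u_kh.
       0 < h \<and> h < min h0 (1 / lam) \<and> 1 / h \<in> \<nat> \<and>
       c1 * k powr (2/3) \<le> h \<and> h \<le> c2 * k powr (2/3) \<and>
       discrete_solution lam g f (\<T> k) h u_kh \<longrightarrow>
       (\<forall>x\<in>\<Union>(\<T> k). \<forall>a\<in>control_grid h.
          \<bar>value_function \<Omega> lam g f x a - u_kh x a\<bar> \<le> C * k powr (2/3 * \<gamma>)))"
    using convergence_rate[OF assms(1) L(2) assms(3-5) assms(8) L(3), of h0 \<chi>1 \<chi>2 c2, folded L(4)] by (rule exE)
  show ?thesis
  proof (rule exI[of _ C], intro allI impI)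
    fix \<Omega> :: "'a set" and g and f :: "'a \<Rightarrow> real \<Rightarrow> real" and \<K> \<T>
    assume *: "open \<Omega> \<and> lipschitz_bounded \<Omega> Lg Mg g \<and> lipschitz_bounded \<Omega> Lf Mf f \<and> viable \<Omega> g \<and>
      triangulation_family \<Omega> g h0 \<chi>1 \<chi>2 \<K> \<T>"
    then have lip: "lipschitz_bounded \<Omega> L Mg g"
      using L(1) lipschitz_bounded_mono by blast
    show "\<forall>k\<in>\<K>. \<forall>h u_kh.
       0 < h \<and> h < min h0 (1 / lam) \<and> 1 / h \<in> \<nat> \<and>
       c1 * k powr (2/3) \<le> h \<and> h \<le> c2 * k powr (2/3) \<and>
       discrete_solution lam g f (\<T> k) h u_kh \<longrightarrow>
       (\<forall>x\<in>\<Union>(\<T> k). \<forall>a\<in>control_grid h.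
          \<bar>value_function \<Omega> lam g f x a - u_kh x a\<bar> \<le> C * k powr (2/3 * \<gamma>))"
      by (rule C[THEN spec, THEN spec, THEN spec, THEN spec, THEN spec, THEN mp]) (simp add: * lip)
  qed
qed

end
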